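(* Let $\mathfrak{h}$ be a six-dimensional real nilpotent Lie algebra admitting a nearly half-flat $SU(3)$-structure given by a pair $(\omega,\psi_-)$, $\omega\in\Lambda^2\mathfrak{h}^*$, $\psi_-\in\Lambda^3\mathfrak{h}^*$, so $d\psi_-=\tfrac12\,\omega\wedge\omega$. Let $\mathfrak{g}=\mathfrak{h}\oplus\mathbb{R}X$ be the direct sum of Lie algebras (so $X$ is central in $\mathfrak{g}$), and let $\theta\in\Lambda^1\mathfrak{g}^*$ be a closed 1-form with $\theta(X)=1$. Then the seven-dimensional Lie algebra $\mathfrak{g}$ admits a locally conformally cocalibrated $G_2$-structure with Lee form $\theta$.
   Context: Forms on a Lie algebra are identified with left-invariant forms on the corresponding Lie group; $d$ is the Chevalley–Eilenberg differential, with $d\alpha(Y,Z)=-\alpha([Y,Z])$ on 1-forms. An $SU(3)$-structure on a six-dimensional Lie algebra $\mathfrak{h}$ is given by a 2-form $\omega$ and 3-forms $\psi_\pm$ for which there is a basis $e^1,\dots,e^6$ of $\mathfrak{h}^*$ with $\omega=e^{12}+e^{34}+e^{56}$ and $\psi_++i\psi_-=(e^1+ie^2)\wedge(e^3+ie^4)\wedge(e^5+ie^6)$ (where $e^{ij}=e^i\wedge e^j$). It is determined by the pair $(\omega,\psi_-)$. It is nearly half-flat if $d\psi_-=\tfrac12\,\omega\wedge\omega$. A $G_2$-structure on a seven-dimensional Lie algebra $\mathfrak{g}$ is a 3-form $\varphi\in\Lambda^3\mathfrak{g}^*$ which in some basis $e^1,\dots,e^7$ of $\mathfrak{g}^*$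 reads $\varphi=e^{127}+e^{347}+e^{567}+e^{135}-e^{146}-e^{236}-e^{245}$. It induces the inner product and orientation for which this basis is oriented orthonormal; $*$ is the corresponding Hodge star, and $\phi=*\varphi$. The structure is locally conformally cocalibrated, with Lee form $\theta$, if $d\phi=\theta\wedge\phi$ for a closed nonzero 1-form $\theta$. *)

theory Defs
  imports "HOL-Analysis.Analysis" "HOL-Library.Function_Algebras"
begin

section \<open>Alternating forms\<close>

text \<open>
  Functions into a real vector space form a real vector space pointwise. With this instance
  \<open>span\<close> and \<open>independent\<close> apply to forms.
\<close>

instantiation "fun" :: (type, real_vector) real_vector
begin

definition scaleR_fun :: "real \<Rightarrow> ('a \<Rightarrow> 'b) \<Rightarrow> 'a \<Rightarrow> 'b"
  where "scaleR_fun c f = (\<lambda>x. c *\<^sub>R f x)"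

instance
  by standard (auto simp: scaleR_fun_def plus_fun_def scaleR_add_right scaleR_add_left)

end

text \<open>
  A form takes the list of its arguments. A \<open>k\<close>-form vanishes on lists whose length is not \<open>k\<close>,
  so that equality of \<open>k\<close>-forms is equality of functions and the operations below need no degree
  parameter.
\<close>

type_synonym ('v, 'k) form = "'v list \<Rightarrow> 'k"

definition alt_form :: "nat \<Rightarrow> ('v::real_vector, 'k::real_vector) form \<Rightarrow> bool"
  where "alt_form k \<alpha> \<longleftrightarrow>
    (\<forall>vs. length vs \<noteq> k \<longrightarrow> \<alpha> vs = 0) \<and>
    (\<forall>us ws. linear (\<lambda>x. \<alpha> (us @ x # ws))) \<and>
    (\<forall>vs. \<not> distinct vs \<longrightarrow> \<alpha> vs = 0)"

text \<open>The sign of the permutation that lists \<open>A\<close> in increasing order and then \<open>B\<close>.\<close>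

definition shuffle_sign :: "nat set \<Rightarrow> nat set \<Rightarrow> 'k::comm_ring_1"
  where "shuffle_sign A B = (- 1) ^ card {(a, b). a \<in> A \<and> b \<in> B \<and> b < a}"

text \<open>
  The wedge product as a sum over shuffles. For 1-forms this is the convention
  \<open>(\<alpha> \<and> \<beta>)(Y,Z) = \<alpha>(Y)\<beta>(Z) - \<alpha>(Z)\<beta>(Y)\<close>, see \<open>wedge_one_forms\<close> below.
\<close>

definition wedge :: "('v, 'k::comm_ring_1) form \<Rightarrow> ('v, 'k) form \<Rightarrow> ('v, 'k) form"
    (infixr "\<^bold>\<and>" 70)
  where "(\<alpha> \<^bold>\<and> \<beta>) = (\<lambda>vs. \<Sum>S\<in>Pow {..<length vs}.
    shuffle_sign S ({..<length vs} - S) * \<alpha> (nths vs S) * \<beta> (nths vs ({..<length vs} - S)))"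

definition unit_form :: "('v, 'k::comm_ring_1) form"
  where "unit_form vs = (if vs = [] then 1 else 0)"

definition complex_form :: "('v, real) form \<Rightarrow> ('v, real) form \<Rightarrow> ('v, complex) form"
  where "complex_form \<alpha> \<beta> = (\<lambda>vs. Complex (\<alpha> vs) (\<beta> vs))"

text \<open>\<open>coframe n e\<close>: the 1-forms \<open>e 1, \<dots>, e n\<close> are a basis of the dual space.\<close>

definition coframe :: "nat \<Rightarrow> (nat \<Rightarrow> ('v::real_vector, real) form) \<Rightarrow> bool"
  where "coframe n e \<longleftrightarrow>
    inj_on e {1..n} \<and> independent (e ` {1..n}) \<and> span (e ` {1..n}) = {\<alpha>. alt_form 1 \<alpha>}"

definition dual_frame :: "nat \<Rightarrow> (nat \<Rightarrow> ('v, real) form) \<Rightarrow> nat \<Rightarrow> 'v"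
  where "dual_frame n e j = (THE v. \<forall>i\<in>{1..n}. e i [v] = (if i = j then 1 else 0))"

text \<open>\<open>wedge_set e I\<close> is \<open>e i\<^sub>1 \<and> \<dots> \<and> e i\<^sub>k\<close> for \<open>I = {i\<^sub>1 < \<dots> < i\<^sub>k}\<close>.\<close>

definition wedge_set :: "(nat \<Rightarrow> ('v, real) form) \<Rightarrow> nat set \<Rightarrow> ('v, real) form"
  where "wedge_set e I = foldr (\<^bold>\<and>) (map e (sorted_list_of_set I)) unit_form"

text \<open>
  The Hodge star of the inner product and orientation for which the coframe \<open>e\<close> is oriented
  orthonormal. A form \<open>\<alpha>\<close> is the sum of its components \<open>\<alpha>(E\<^sub>I) e\<^sup>I\<close>, with \<open>E\<close> the frame dual to
  \<open>e\<close>, and \<open>e\<^sup>I\<close> is sent to the multiple of \<open>e\<^sup>J\<close>, with \<open>J\<close> the complement of \<open>I\<close>, for which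
  \<open>e\<^sup>I \<and> *e\<^sup>I = e\<^sup>1 \<and> \<dots> \<and> e\<^sup>n\<close>.
\<close>

definition hodge_star ::
    "nat \<Rightarrow> (nat \<Rightarrow> ('v, real) form) \<Rightarrow> ('v, real) form \<Rightarrow> ('v, real) form"
  where "hodge_star n e \<alpha> = (\<Sum>I\<in>Pow {1..n}.
    (\<alpha> (map (dual_frame n e) (sorted_list_of_set I)) * shuffle_sign I ({1..n} - I))
      *\<^sub>R wedge_set e ({1..n} - I))"


section \<open>Lie algebras\<close>

definition lie_algebra :: "('v::real_vector \<Rightarrow> 'v \<Rightarrow> 'v) \<Rightarrow> bool"
  where "lie_algebra br \<longleftrightarrow>
    bilinear br \<and> (\<forall>x. br x x = 0) \<and>
    (\<forall>x y z. br x (br y z) + br y (br z x) + br z (br x y) = 0)"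

fun lower_central :: "('v::real_vector \<Rightarrow> 'v \<Rightarrow> 'v) \<Rightarrow> nat \<Rightarrow> 'v set"
  where
    "lower_central br 0 = UNIV"
  | "lower_central br (Suc n) = span {br x y |x y. y \<in> lower_central br n}"

definition nilpotent_lie :: "('v::real_vector \<Rightarrow> 'v \<Rightarrow> 'v) \<Rightarrow> bool"
  where "nilpotent_lie br \<longleftrightarrow> (\<exists>n. lower_central br n = {0})"

definition lie_direct_sum ::
    "('v \<Rightarrow> 'v \<Rightarrow> 'v) \<Rightarrow> ('w \<Rightarrow> 'w \<Rightarrow> 'w) \<Rightarrow> 'v \<times> 'w \<Rightarrow> 'v \<times> 'w \<Rightarrow> 'v \<times> 'w"
  where "lie_direct_sum br br' p q = (br (fst p) (fst q), br' (snd p) (snd q))"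

text \<open>
  The Chevalley--Eilenberg differential
  \<open>d\<alpha>(v\<^sub>0,\<dots>,v\<^sub>k) = \<Sum>\<^bsub>i<j\<^esub> (-1)\<^bsup>i+j\<^esup> \<alpha>([v\<^sub>i,v\<^sub>j], v\<^sub>0,\<dots>,v\<^sub>k)\<close>, with \<open>v\<^sub>i\<close> and \<open>v\<^sub>j\<close> omitted
  from the trailing arguments.
\<close>

definition ce_diff :: "('v \<Rightarrow> 'v \<Rightarrow> 'v) \<Rightarrow> ('v, real) form \<Rightarrow> ('v, real) form"
  where "ce_diff br \<alpha> = (\<lambda>vs. \<Sum>j<length vs. \<Sum>i<j.
    (- 1) ^ (i + j) * \<alpha> (br (vs ! i) (vs ! j) # nths vs (- {i, j})))"


section \<open>The structures\<close>

definition su3_structure ::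
    "('v::real_vector, real) form \<Rightarrow> ('v, real) form \<Rightarrow> ('v, real) form \<Rightarrow> bool"
  where "su3_structure \<omega> \<psi>p \<psi>m \<longleftrightarrow> (\<exists>e. coframe 6 e \<and>
    \<omega> = e 1 \<^bold>\<and> e 2 + e 3 \<^bold>\<and> e 4 + e 5 \<^bold>\<and> e 6 \<and>
    complex_form \<psi>p \<psi>m =
      complex_form (e 1) (e 2) \<^bold>\<and> complex_form (e 3) (e 4) \<^bold>\<and> complex_form (e 5) (e 6))"

definition nearly_half_flat ::
    "('v \<Rightarrow> 'v \<Rightarrow> 'v) \<Rightarrow> ('v, real) form \<Rightarrow> ('v, real) form \<Rightarrow> bool"
  where "nearly_half_flat br \<omega> \<psi>m \<longleftrightarrow> ce_diff br \<psi>m = (1 / 2) *\<^sub>R (\<omega> \<^bold>\<and> \<omega>)"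

definition g2_coframe ::
    "(nat \<Rightarrow> ('v::real_vector, real) form) \<Rightarrow> ('v, real) form \<Rightarrow> bool"
  where "g2_coframe e \<phi> \<longleftrightarrow> coframe 7 e \<and>
    \<phi> = e 1 \<^bold>\<and> e 2 \<^bold>\<and> e 7 + e 3 \<^bold>\<and> e 4 \<^bold>\<and> e 7 + e 5 \<^bold>\<and> e 6 \<^bold>\<and> e 7
      + e 1 \<^bold>\<and> e 3 \<^bold>\<and> e 5 - e 1 \<^bold>\<and> e 4 \<^bold>\<and> e 6 - e 2 \<^bold>\<and> e 3 \<^bold>\<and> e 6 - e 2 \<^bold>\<and> e 4 \<^bold>\<and> e 5"

text \<open>
  The stabiliser of \<open>\<phi>\<close> lies in SO(7), so any two coframes adapted to \<open>\<phi>\<close> have the same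
  Hodge star, and it does not matter which one is used to form \<open>*\<phi>\<close>.
\<close>

definition lc_cocalibrated_g2 ::
    "('v::real_vector \<Rightarrow> 'v \<Rightarrow> 'v) \<Rightarrow> ('v, real) form \<Rightarrow> ('v, real) form \<Rightarrow> bool"
  where "lc_cocalibrated_g2 br \<theta> \<phi> \<longleftrightarrow>
    alt_form 1 \<theta> \<and> \<theta> \<noteq> 0 \<and> ce_diff br \<theta> = 0 \<and>
    (\<exists>e. g2_coframe e \<phi> \<and>
      ce_diff br (hodge_star 7 e \<phi>) = \<theta> \<^bold>\<and> hodge_star 7 e \<phi>)"


section \<open>Conventions in low degree\<close>

lemma wedge_one_forms:
  assumes "alt_form 1 \<alpha>" and "alt_form 1 \<beta>"
  shows "(\<alpha> \<^bold>\<and> \<beta>) [Y, Z] = \<alpha> [Y] * \<beta> [Z] - \<alpha> [Z] * (\<beta> [Y] :: real)"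
proof -
  have z: "\<alpha> [] = 0" "\<beta> [] = 0" using assms by (simp_all add: alt_form_def)
  have P: "Pow {..<2::nat} = {{}, {0}, {1}, {0, 1}}"
    by (simp add: numeral_2_eq_2 lessThan_Suc Pow_insert insert_commute)
  have D: "{..<2::nat} - {0} = {1}" "{..<2::nat} - {1} = {0}" "{..<2::nat} - {0, 1} = {}"
    by auto
  have s: "shuffle_sign {0} {1} = (1::real)" "shuffle_sign {1} {0} = (- 1 :: real)"
  proof -
    have "{(a, b). a \<in> {0::nat} \<and> b \<in> {1::nat} \<and> b < a} = {}"
      and "{(a, b). a \<in> {1::nat} \<and> b \<in> {0::nat} \<and> b < a} = {(1, 0)}" by auto
    then show "shuffle_sign {0} {1} = (1::real)" "shuffle_sign {1} {0} = (- 1 :: real)"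
      unfolding shuffle_sign_def by (simp_all only: card.empty power_0, simp)
  qed
  have sum4: "sum f {{}, {0::nat}, {1}, {0, 1}} = f {} + f {0} + f {1} + f {0, 1}" for f :: "nat set \<Rightarrow> real"
  proof -
    have "{0, 1} \<noteq> {0::nat}" "{0, 1} \<noteq> {1::nat}" by auto
    then show ?thesis by (simp add: add.assoc)
  qed
  have n: "nths [Y, Z] {0} = [Y]" "nths [Y, Z] {1} = [Z]" "nths [Y, Z] {} = []"
    by (simp_all add: nths_Cons)
  have "(\<alpha> \<^bold>\<and> \<beta>) [Y, Z] = (\<Sum>S\<in>{{}, {0}, {1}, {0, 1}}.
      shuffle_sign S ({..<2} - S) * \<alpha> (nths [Y, Z] S) * \<beta> (nths [Y, Z] ({..<2} - S)))"
    unfolding wedge_def P[symmetric] by (simp add: numeral_2_eq_2)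
  also have "\<dots> = \<alpha> [Y] * \<beta> [Z] - \<alpha> [Z] * \<beta> [Y]"
    by (simp add: sum4 D s n z del: One_nat_def)
  finally show ?thesis .
qed

lemma ce_diff_one_form: "ce_diff br \<alpha> [Y, Z] = - \<alpha> [br Y Z]"
  by (simp add: ce_diff_def lessThan_Suc nths_Cons)

end

theory Submission
  imports Defs
begin

text \<open>
  Let \<open>e\<^sup>1, \<dots>, e\<^sup>6\<close> be a coframe adapted to the SU(3)-structure, pulled back to \<open>g = h \<oplus> \<real>X\<close>. Because
  \<open>\<theta>(X) = 1\<close>, adding \<open>e\<^sup>7 = \<theta>\<close> gives a coframe of \<open>g\<close> (\<open>coframe_extend\<close>), and it defines the
  G2-structure \<open>\<phi> = \<omega> \<and> \<theta> + \<psi>\<^sub>+\<close>. Its dual form is \<open>*\<phi> = \<sigma> + \<psi>\<^sub>- \<and> \<theta>\<close> with \<open>\<sigma> = \<omega> \<and> \<omega> / 2\<close>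
  (\<open>hodge_star_g2\<close>, \<open>half_omega_squared\<close>, \<open>su3_psi_minus\<close>). The hypothesis \<open>d\<psi>\<^sub>- = \<sigma>\<close> implies
  \<open>d\<sigma> = 0\<close>, so the Leibniz rule and \<open>d\<theta> = 0\<close> give \<open>d(*\<phi>) = \<sigma> \<and> \<theta>\<close>. On the other hand
  \<open>\<theta> \<and> *\<phi> = \<theta> \<and> \<sigma> + \<theta> \<and> \<psi>\<^sub>- \<and> \<theta> = \<sigma> \<and> \<theta>\<close>, as \<open>\<sigma>\<close> has even degree and \<open>\<theta> \<and> \<theta> = 0\<close>.

  The computation rests on the calculus of left-invariant forms: associativity and graded
  commutativity of the wedge product, the Leibniz rule (\<open>ce_diff_wedge\<close>) and \<open>d\<^sup>2 = 0\<close>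
  (\<open>ce_diff_ce_diff\<close>). All of it is obtained from interior products. The wedge product, the Lie
  derivative and the differential each obey a rule for \<open>\<iota>\<^sub>x\<close> (\<open>wedge_Cons\<close>,
  \<open>contract_lie_deriv\<close> and Cartan's formula \<open>contract_ce_diff\<close>), and since a form is a function of
  a list of vectors, such a rule is a recursion along the list. An identity between forms then
  follows by induction once both sides are seen to have the same interior products.

  The Hodge star is computed on monomials: the dual frame in its definition exists and is unique
  (\<open>dual_frame\<close>), and the monomials \<open>e\<^sup>I\<close> are dual to the multivectors of that frame, so that only
  one component of each monomial survives (\<open>hodge_star_wedge_set\<close>).
\<close>

section \<open>The exterior algebra through interior products\<close>

definition contract :: "'v \<Rightarrow> ('v, 'k) form \<Rightarrow> ('v, 'k) form"
  where "contract x \<alpha> = (\<lambda>vs. \<alpha> (x # vs))"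

text \<open>
  The grading involution, \<open>(-1)\<^sup>k\<close> on \<open>k\<close>-forms. It puts the signs of graded rules such as
  \<open>\<iota>\<^sub>x(\<alpha> \<and> \<beta>) = \<iota>\<^sub>x\<alpha> \<and> \<beta> + (-1)\<^sup>k \<alpha> \<and> \<iota>\<^sub>x\<beta>\<close> into an operator, so that the rules make sense, and can
  be proved by induction, for functions of lists that are not homogeneous.
\<close>

definition grade_inv :: "('v, 'k::comm_ring_1) form \<Rightarrow> ('v, 'k) form"
  where "grade_inv \<alpha> = (\<lambda>vs. (- 1) ^ length vs * \<alpha> vs)"

lemma contract_apply [simp]: "contract x \<alpha> vs = \<alpha> (x # vs)"
  by (simp add: contract_def)

lemma contract_simps [simp]:
  "contract x 0 = 0" "contract x (\<alpha> + \<beta>) = contract x \<alpha> + contract x \<beta>"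
  "contract x (\<alpha> - \<beta>) = contract x \<alpha> - contract x (\<beta> :: ('v, 'k::ab_group_add) form)"
  by (auto simp: contract_def fun_eq_iff zero_fun_def)

lemma grade_inv_simps [simp]:
  "grade_inv (grade_inv \<alpha>) = \<alpha>" "grade_inv 0 = 0"
  "grade_inv (\<alpha> + \<beta>) = grade_inv \<alpha> + grade_inv \<beta>"
  "grade_inv (\<alpha> - \<beta>) = grade_inv \<alpha> - grade_inv \<beta>"
  "grade_inv (- \<alpha>) = - grade_inv \<alpha>"
  by (auto simp: grade_inv_def fun_eq_iff zero_fun_def algebra_simps simp flip: power_add mult.assoc)

lemma contract_grade_inv: "contract x (grade_inv \<alpha>) = - grade_inv (contract x \<alpha>)"
  by (auto simp: grade_inv_def fun_eq_iff)

lemma shuffle_sign_insert_0_Suc: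
  "shuffle_sign (insert 0 (Suc ` S)) (Suc ` T) = shuffle_sign S T"
proof -
  have "{(a, b). a \<in> insert 0 (Suc ` S) \<and> b \<in> Suc ` T \<and> b < a}
      = (\<lambda>(a, b). (Suc a, Suc b)) ` {(a, b). a \<in> S \<and> b \<in> T \<and> b < a}"
    by auto
  moreover have "inj_on (\<lambda>(a, b). (Suc a, Suc b)) X" for X by (auto simp: inj_on_def)
  ultimately show ?thesis by (simp add: shuffle_sign_def card_image)
qed

lemma shuffle_sign_Suc_insert_0:
  assumes "finite S" "finite T"
  shows "shuffle_sign (Suc ` S) (insert 0 (Suc ` T)) = (- 1) ^ card S * shuffle_sign S T"
proof -
  let ?I = "{(a, b). a \<in> S \<and> b \<in> T \<and> b < a}"
  have "{(a, b). a \<in> Suc ` S \<and> b \<in> insert 0 (Suc ` T) \<and> b < a}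
      = (\<lambda>a. (Suc a, 0)) ` S \<union> (\<lambda>(a, b). (Suc a, Suc b)) ` ?I"
    by auto
  moreover have "finite ?I"
    by (rule finite_subset[of _ "S \<times> T"]) (use assms in auto)
  moreover have "inj_on (\<lambda>(a, b). (Suc a, Suc b)) X" "inj_on (\<lambda>a. (Suc a, 0::nat)) Y" for X Y
    by (auto simp: inj_on_def)
  moreover have "(\<lambda>a. (Suc a, 0)) ` S \<inter> (\<lambda>(a, b). (Suc a, Suc b)) ` ?I = {}" by auto
  ultimately show ?thesis
    using assms by (simp add: shuffle_sign_def card_image card_Un_disjoint power_add)
qed

lemma wedge_Nil [simp]: "(\<alpha> \<^bold>\<and> \<beta>) [] = \<alpha> [] * \<beta> []"
  by (simp add: wedge_def shuffle_sign_def)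

text \<open>
  The shuffles of \<open>x # vs\<close> split according to whether \<open>x\<close> goes to the left or to the right
  factor. In the second case \<open>x\<close> jumps over all arguments of \<open>\<alpha>\<close>, which gives the involution.
  Together with \<open>wedge_Nil\<close> this is a recursive description of the wedge product as a product of
  arbitrary functions of lists, from which its other properties follow by induction on the list.
\<close>

lemma wedge_Cons:
  "(\<alpha> \<^bold>\<and> \<beta>) (x # vs) = (contract x \<alpha> \<^bold>\<and> \<beta>) vs + (grade_inv \<alpha> \<^bold>\<and> contract x \<beta>) vs"
proof -
  let ?N = "{..<length vs}"
  let ?f = "\<lambda>S. shuffle_sign S ({..<length (x # vs)} - S) * \<alpha> (nths (x # vs) S)
      * \<beta> (nths (x # vs) ({..<length (x # vs)} - S))"
  have N: "{..<length (x # vs)} = insert 0 (Suc ` ?N)"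
    by (simp add: lessThan_Suc_eq_insert_0)
  have P: "Pow (Suc ` ?N) = image Suc ` Pow ?N"
    by (simp add: image_Pow_surj)
  have inj: "inj_on (image Suc) X" for X
    by (meson inj_Suc inj_image_eq_iff inj_onI)
  have inj0: "inj_on (insert 0) (image Suc ` Pow ?N)"
    by (rule inj_onI) (metis (no_types, lifting) Diff_insert_absorb imageE insertE nat.distinct(1))
  have "(\<alpha> \<^bold>\<and> \<beta>) (x # vs) = sum ?f (Pow (insert 0 (Suc ` ?N)))"
    unfolding wedge_def N[symmetric] ..
  also have "\<dots> = sum ?f (insert 0 ` image Suc ` Pow ?N) + sum ?f (image Suc ` Pow ?N)"
    unfolding Pow_insert P by (subst sum.union_disjoint) (auto simp: add.commute)
  also have "sum ?f (insert 0 ` image Suc ` Pow ?N) = (contract x \<alpha> \<^bold>\<and> \<beta>) vs"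
  proof -
    have "?f (insert 0 (Suc ` S)) = shuffle_sign S (?N - S) * contract x \<alpha> (nths vs S)
        * \<beta> (nths vs (?N - S))" if "S \<in> Pow ?N" for S
    proof -
      have "insert 0 (Suc ` ?N) - insert 0 (Suc ` S) = Suc ` (?N - S)" by auto
      moreover have "{j. j < length vs \<and> j \<notin> S} = ?N - S" by auto
      ultimately show ?thesis
        unfolding N by (simp add: nths_Cons shuffle_sign_insert_0_Suc image_iff)
    qed
    then show ?thesis
      unfolding wedge_def by (simp only: sum.reindex[OF inj0] sum.reindex[OF inj] o_def cong: sum.cong)
  qed
  also have "sum ?f (image Suc ` Pow ?N) = (grade_inv \<alpha> \<^bold>\<and> contract x \<beta>) vs"
  proof -
    have "?f (Suc ` S) = shuffle_sign S (?N - S) * grade_inv \<alpha> (nths vs S)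
        * contract x \<beta> (nths vs (?N - S))" if "S \<in> Pow ?N" for S
    proof -
      have "insert 0 (Suc ` ?N) - Suc ` S = insert 0 (Suc ` (?N - S))" by auto
      moreover have "length (nths vs S) = card S"
        using that by (auto simp: length_nths intro!: arg_cong[of _ _ card])
      moreover have "finite S" using that finite_subset by auto
      moreover have "{j. j < length vs \<and> j \<notin> S} = ?N - S" by auto
      ultimately show ?thesis
        unfolding N by (simp add: nths_Cons shuffle_sign_Suc_insert_0 image_iff grade_inv_def mult_ac)
    qed
    then show ?thesis
      unfolding wedge_def by (simp only: sum.reindex[OF inj] o_def cong: sum.cong)
  qed
  finally show ?thesis .
qed

lemma contract_wedge:
  "contract x (\<alpha> \<^bold>\<and> \<beta>) = contract x \<alpha> \<^bold>\<and> \<beta> + grade_inv \<alpha> \<^bold>\<and> contract x \<beta>"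
  by (simp add: fun_eq_iff wedge_Cons)

lemma wedge_linear:
  "(\<alpha> + \<alpha>') \<^bold>\<and> \<beta> = \<alpha> \<^bold>\<and> \<beta> + \<alpha>' \<^bold>\<and> \<beta>" "\<alpha> \<^bold>\<and> (\<beta> + \<beta>') = \<alpha> \<^bold>\<and> \<beta> + \<alpha> \<^bold>\<and> \<beta>'"
  "(\<alpha> - \<alpha>') \<^bold>\<and> \<beta> = \<alpha> \<^bold>\<and> \<beta> - \<alpha>' \<^bold>\<and> \<beta>" "\<alpha> \<^bold>\<and> (\<beta> - \<beta>') = \<alpha> \<^bold>\<and> \<beta> - \<alpha> \<^bold>\<and> \<beta>'"
  "(- \<alpha>) \<^bold>\<and> \<beta> = - (\<alpha> \<^bold>\<and> \<beta>)" "\<alpha> \<^bold>\<and> (- \<beta>) = - (\<alpha> \<^bold>\<and> \<beta>)"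
  "0 \<^bold>\<and> \<beta> = 0" "\<alpha> \<^bold>\<and> 0 = 0"
  by (auto simp: wedge_def fun_eq_iff algebra_simps sum.distrib sum_subtractf sum_negf zero_fun_def)

lemma wedge_scaleR:
  fixes \<alpha> \<beta> :: "('v, real) form"
  shows "(c *\<^sub>R \<alpha>) \<^bold>\<and> \<beta> = c *\<^sub>R (\<alpha> \<^bold>\<and> \<beta>)" "\<alpha> \<^bold>\<and> (c *\<^sub>R \<beta>) = c *\<^sub>R (\<alpha> \<^bold>\<and> \<beta>)"
  by (auto simp: wedge_def fun_eq_iff scaleR_fun_def sum_distrib_left mult_ac intro!: sum.cong)

lemma grade_inv_wedge: "grade_inv (\<alpha> \<^bold>\<and> \<beta>) = grade_inv \<alpha> \<^bold>\<and> grade_inv \<beta>"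
proof
  fix vs show "grade_inv (\<alpha> \<^bold>\<and> \<beta>) vs = (grade_inv \<alpha> \<^bold>\<and> grade_inv \<beta>) vs"
  proof (induction vs arbitrary: \<alpha> \<beta>)
    case Nil
    then show ?case by (simp add: grade_inv_def)
  next
    case (Cons x vs)
    have "grade_inv (\<alpha> \<^bold>\<and> \<beta>) (x # vs) = - grade_inv (contract x (\<alpha> \<^bold>\<and> \<beta>)) vs"
      by (simp add: grade_inv_def)
    also have "\<dots> = contract x (grade_inv \<alpha> \<^bold>\<and> grade_inv \<beta>) vs"
      by (simp add: contract_wedge contract_grade_inv wedge_linear Cons.IH del: contract_apply)
    finally show ?case by simp
  qed
qed

text \<open>
  Both sides obey the same recursion, since \<open>\<iota>\<^sub>x\<close> is an antiderivation and the involution is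
  multiplicative.
\<close>

lemma wedge_assoc: "(\<alpha> \<^bold>\<and> \<beta>) \<^bold>\<and> \<gamma> = \<alpha> \<^bold>\<and> (\<beta> \<^bold>\<and> \<gamma>)"
proof
  fix vs show "((\<alpha> \<^bold>\<and> \<beta>) \<^bold>\<and> \<gamma>) vs = (\<alpha> \<^bold>\<and> (\<beta> \<^bold>\<and> \<gamma>)) vs"
    by (induction vs arbitrary: \<alpha> \<beta> \<gamma>)
      (simp_all add: wedge_Cons contract_wedge wedge_linear grade_inv_wedge add_ac mult_ac)
qed

lemma contract_unit_form [simp]: "contract x unit_form = 0"
  by (simp add: fun_eq_iff unit_form_def zero_fun_def)

lemma grade_inv_unit_form [simp]: "grade_inv unit_form = unit_form"
  by (simp add: fun_eq_iff unit_form_def grade_inv_def)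

lemma wedge_unit_form [simp]: "unit_form \<^bold>\<and> \<alpha> = \<alpha>" "\<alpha> \<^bold>\<and> unit_form = \<alpha>"
proof -
  have "(unit_form \<^bold>\<and> \<alpha>) vs = \<alpha> vs" for vs
    by (induction vs arbitrary: \<alpha>) (simp_all add: wedge_Cons wedge_linear, simp_all add: unit_form_def)
  moreover have "(\<alpha> \<^bold>\<and> unit_form) vs = \<alpha> vs" for vs
    by (induction vs arbitrary: \<alpha>) (simp_all add: wedge_Cons wedge_linear, simp_all add: unit_form_def)
  ultimately show "unit_form \<^bold>\<and> \<alpha> = \<alpha>" "\<alpha> \<^bold>\<and> unit_form = \<alpha>" by blast+
qed

lemma alt_formD:
  assumes "alt_form k \<alpha>"
  shows "length vs \<noteq> k \<Longrightarrow> \<alpha> vs = 0" "linear (\<lambda>x. \<alpha> (us @ x # ws))" "\<not> distinct vs \<Longrightarrow> \<alpha> vs = 0"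
    "linear (\<lambda>x. \<alpha> (x # ws))" "\<alpha> (x # x # ws) = 0"
proof -
  have lin: "linear (\<lambda>x. \<alpha> (us @ x # ws))" for us ws
    using assms by (simp add: alt_form_def)
  then show "linear (\<lambda>x. \<alpha> (us @ x # ws))" .
  show "linear (\<lambda>x. \<alpha> (x # ws))" using lin[of "[]"] by simp
qed (use assms in \<open>auto simp: alt_form_def\<close>)

lemma grade_inv_alt_form:
  fixes \<alpha> :: "('v::real_vector, real) form"
  shows "alt_form k \<alpha> \<Longrightarrow> grade_inv \<alpha> = (- 1) ^ k *\<^sub>R \<alpha>"
proof
  fix vs assume "alt_form k \<alpha>"
  then show "grade_inv \<alpha> vs = ((- 1) ^ k *\<^sub>R \<alpha>) vs"
    by (cases "length vs = k") (auto simp: grade_inv_def scaleR_fun_def alt_formD(1))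
qed

lemma grade_inv_one_form:
  fixes \<alpha> :: "('v::real_vector, real) form"
  shows "alt_form 1 \<alpha> \<Longrightarrow> grade_inv \<alpha> = - \<alpha>"
  by (simp add: grade_inv_alt_form fun_eq_iff scaleR_fun_def)

lemma contract_one_form:
  fixes \<alpha> :: "('v::real_vector, real) form"
  shows "alt_form 1 \<alpha> \<Longrightarrow> contract x \<alpha> = \<alpha> [x] *\<^sub>R unit_form"
  by (auto simp: fun_eq_iff scaleR_fun_def unit_form_def alt_formD(1))

text \<open>
  Graded commutativity in the case where one factor has degree one; this generates all
  reorderings of products of 1-forms. The induction works because \<open>\<iota>\<^sub>x\<theta>\<close> is a scalar.
\<close>

lemma one_form_wedge_commute:
  fixes \<theta> :: "('v::real_vector, real) form"
  assumes "alt_form 1 \<theta>"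
  shows "\<theta> \<^bold>\<and> \<beta> = grade_inv \<beta> \<^bold>\<and> \<theta>"
proof
  fix vs show "(\<theta> \<^bold>\<and> \<beta>) vs = (grade_inv \<beta> \<^bold>\<and> \<theta>) vs"
  proof (induction vs arbitrary: \<beta>)
    case Nil
    then show ?case by (simp add: alt_formD(1)[OF assms])
  next
    case (Cons x vs)
    show ?case
      by (simp add: wedge_Cons contract_one_form[OF assms] grade_inv_one_form[OF assms] wedge_scaleR wedge_linear
          contract_grade_inv Cons.IH del: contract_apply)
  qed
qed

lemma one_form_wedge_self:
  fixes \<theta> :: "('v::real_vector, real) form"
  assumes "alt_form 1 \<theta>"
  shows "\<theta> \<^bold>\<and> \<theta> = 0"
proof -
  have "\<theta> \<^bold>\<and> \<theta> = - (\<theta> \<^bold>\<and> \<theta>)"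
    using one_form_wedge_commute[OF assms, of \<theta>] by (simp add: grade_inv_one_form[OF assms] wedge_linear)
  then show ?thesis by (simp add: fun_eq_iff zero_fun_def)
qed

section \<open>Complex forms and pullbacks\<close>

lemma contract_complex_form:
  "contract x (complex_form \<alpha> \<beta>) = complex_form (contract x \<alpha>) (contract x \<beta>)"
  by (simp add: fun_eq_iff complex_form_def)

lemma grade_inv_complex_form:
  "grade_inv (complex_form \<alpha> \<beta>) = complex_form (grade_inv \<alpha>) (grade_inv \<beta>)"
  by (simp add: fun_eq_iff complex_form_def grade_inv_def minus_one_power_iff complex_eq_iff)

lemma wedge_complex_form:
  "complex_form \<alpha> \<beta> \<^bold>\<and> complex_form \<gamma> \<delta>
    = complex_form (\<alpha> \<^bold>\<and> \<gamma> - \<beta> \<^bold>\<and> \<delta>) (\<alpha> \<^bold>\<and> \<delta> + \<beta> \<^bold>\<and> \<gamma>)"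
proof
  fix vs show "(complex_form \<alpha> \<beta> \<^bold>\<and> complex_form \<gamma> \<delta>) vs
    = complex_form (\<alpha> \<^bold>\<and> \<gamma> - \<beta> \<^bold>\<and> \<delta>) (\<alpha> \<^bold>\<and> \<delta> + \<beta> \<^bold>\<and> \<gamma>) vs"
  proof (induction vs arbitrary: \<alpha> \<beta> \<gamma> \<delta>)
    case Nil
    then show ?case by (simp add: complex_form_def complex_eq_iff)
  next
    case (Cons x vs)
    have "contract x (complex_form \<alpha> \<beta> \<^bold>\<and> complex_form \<gamma> \<delta>) vs
       = contract x (complex_form (\<alpha> \<^bold>\<and> \<gamma> - \<beta> \<^bold>\<and> \<delta>) (\<alpha> \<^bold>\<and> \<delta> + \<beta> \<^bold>\<and> \<gamma>)) vs"
      unfolding contract_wedge contract_complex_form grade_inv_complex_form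
      by (simp add: Cons.IH contract_wedge del: contract_apply) (simp add: complex_form_def complex_eq_iff)
    then show ?case unfolding contract_apply .
  qed
qed

definition pullback :: "('v \<Rightarrow> 'w) \<Rightarrow> ('w, 'k) form \<Rightarrow> ('v, 'k) form"
  where "pullback f \<alpha> = (\<lambda>vs. \<alpha> (map f vs))"

lemma pullback_wedge: "pullback f (\<alpha> \<^bold>\<and> \<beta>) = pullback f \<alpha> \<^bold>\<and> pullback f \<beta>"
  by (simp add: pullback_def wedge_def nths_map)

lemma pullback_linear:
  "pullback f 0 = 0" "pullback f (\<alpha> + \<beta>) = pullback f \<alpha> + pullback f \<beta>"
  "pullback f (\<alpha> - \<beta>) = pullback f \<alpha> - pullback f (\<beta> :: ('v, real) form)"
  "pullback f (c *\<^sub>R \<beta>) = c *\<^sub>R pullback f \<beta>"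
  by (auto simp: pullback_def fun_eq_iff zero_fun_def scaleR_fun_def)

lemma alt_form_pullback:
  assumes "linear f" "alt_form k \<alpha>"
  shows "alt_form k (pullback f \<alpha>)"
  unfolding alt_form_def pullback_def
proof (intro conjI allI impI)
  show "linear (\<lambda>x. \<alpha> (map f (us @ x # ws)))" for us ws
    using linear_compose[OF assms(1) alt_formD(2)[OF assms(2), of "map f us" "map f ws"]]
    by (simp add: o_def)
qed (use alt_formD(1,3)[OF assms(2)] in \<open>auto simp: distinct_map\<close>)

lemma ce_diff_pullback:
  assumes "\<And>x y. f (br x y) = br' (f x) (f y)"
  shows "ce_diff br (pullback f \<alpha>) = pullback f (ce_diff br' \<alpha>)"
  unfolding ce_diff_def pullback_def
  by (intro ext) (auto intro!: sum.cong simp: assms nths_map)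

section \<open>Alternation through interior products\<close>

lemma alt_form_0_iff: "alt_form 0 \<alpha> \<longleftrightarrow> (\<forall>vs. vs \<noteq> [] \<longrightarrow> \<alpha> vs = 0)"
  by (auto simp: alt_form_def module_hom_zero) (metis distinct.simps(1))

lemma alt_form_zero [simp]: "alt_form k 0"
  by (auto simp: alt_form_def zero_fun_def module_hom_zero)

lemma contract_alt_form_0:
  assumes "alt_form 0 \<alpha>" shows "contract x \<alpha> = 0"
  using assms by (simp add: alt_form_0_iff fun_eq_iff zero_fun_def)

lemma alt_form_Suc_contract:
  assumes "alt_form (Suc k) \<alpha>"
  shows "alt_form k (contract x \<alpha>)"
  unfolding alt_form_def
proof (intro conjI allI impI)
  show "linear (\<lambda>y. contract x \<alpha> (us @ y # ws))" for us ws
    using alt_formD(2)[OF assms, of "x # us" ws] by simp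
qed (use alt_formD(1,3)[OF assms] in auto)

text \<open>
  For \<open>k = 0\<close> the contraction is zero, which is a form of every degree, so truncated subtraction
  gives a correct degree and inductions along a list of arguments need no case distinction.
\<close>

lemma alt_form_contract:
  assumes "alt_form k \<alpha>" shows "alt_form (k - 1) (contract x \<alpha>)"
  using assms by (cases k) (auto simp: contract_alt_form_0 alt_form_Suc_contract)

text \<open>
  Polarisation, in the first two slots only.
\<close>

lemma swap_of_alternating:
  fixes \<alpha> :: "('v::real_vector, real) form"
  assumes "\<And>x. linear (\<lambda>y. \<alpha> (x # y # ws))" "\<And>y. linear (\<lambda>x. \<alpha> (x # y # ws))"
    and "\<And>x. \<alpha> (x # x # ws) = 0"
  shows "\<alpha> (x # y # ws) = - \<alpha> (y # x # ws)"
proof -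
  have "\<alpha> ((x + y) # (x + y) # ws) = \<alpha> (x # x # ws) + \<alpha> (x # y # ws) + \<alpha> (y # x # ws) + \<alpha> (y # y # ws)"
    using linear_add[OF assms(1)] linear_add[OF assms(2)] by simp
  then show ?thesis by (simp add: assms(3))
qed

lemma alt_form_swap:
  fixes \<alpha> :: "('v::real_vector, real) form"
  assumes "alt_form k \<alpha>" shows "\<alpha> (x # y # ws) = - \<alpha> (y # x # ws)"
  using alt_formD(2)[OF assms, of "[_]"] alt_formD(4,5)[OF assms]
  by (intro swap_of_alternating) auto

text \<open>
  Alternation can be checked one slot at a time: it suffices that every \<open>\<iota>\<^sub>x\<alpha>\<close> is alternating and
  that \<open>\<iota>\<^sub>x\<iota>\<^sub>x\<alpha> = 0\<close>. If the first argument is repeated further down the list, swapping the first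
  two slots moves the repetition into the arguments of some \<open>\<iota>\<^sub>u\<alpha>\<close>. This is what lets closure of
  alternating forms under an operator follow from the commutation rule of the operator with \<open>\<iota>\<close>.
\<close>

lemma alt_form_SucI:
  fixes \<alpha> :: "('v::real_vector, real) form"
  assumes "\<alpha> [] = 0" "\<And>x. alt_form k (contract x \<alpha>)" "\<And>ws. linear (\<lambda>x. \<alpha> (x # ws))"
    and "\<And>x ws. \<alpha> (x # x # ws) = 0"
  shows "alt_form (Suc k) \<alpha>"
  unfolding alt_form_def
proof (intro conjI allI impI)
  fix vs :: "'v list"
  show "\<alpha> vs = 0" if "length vs \<noteq> Suc k"
    using that assms(1) alt_formD(1)[OF assms(2)] by (cases vs) auto
  show "\<alpha> vs = 0" if "\<not> distinct vs"
  proof (cases vs)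
    case (Cons x ws)
    have *: "\<alpha> (y # us) = 0" if "\<not> distinct us" for y us
      using alt_formD(3)[OF assms(2) that, of y] by simp
    show ?thesis
    proof (cases "distinct ws")
      case True
      then have "x \<in> set ws" using that Cons by simp
      then obtain us us' where ws: "ws = us @ x # us'" by (meson split_list)
      show ?thesis
      proof (cases us)
        case Nil
        then show ?thesis by (simp add: Cons ws assms(4))
      next
        case (Cons u us1)
        have "\<alpha> (x # u # us1 @ x # us') = - \<alpha> (u # x # us1 @ x # us')"
          using alt_formD(4)[OF assms(2)] assms(3,4) by (intro swap_of_alternating) auto
        also have "\<dots> = 0" by (simp add: *)
        finally show ?thesis by (simp add: \<open>vs = _\<close> ws Cons)
      qed
    qed (simp add: Cons *)
  qed (use that in simp)
next
  fix us ws :: "'v list"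
  show "linear (\<lambda>x. \<alpha> (us @ x # ws))"
    using assms(3) alt_formD(2)[OF assms(2)] by (cases us) auto
qed

lemma alt_form_add:
  fixes \<alpha> \<beta> :: "('v::real_vector, real) form"
  shows "alt_form k \<alpha> \<Longrightarrow> alt_form k \<beta> \<Longrightarrow> alt_form k (\<alpha> + \<beta>)"
  unfolding alt_form_def by (auto intro: linear_compose_add)

lemma alt_form_scaleR:
  fixes \<alpha> :: "('v::real_vector, real) form"
  shows "alt_form k \<alpha> \<Longrightarrow> alt_form k (c *\<^sub>R \<alpha>)"
  using linear_compose_scale_right[of _ c] unfolding alt_form_def scaleR_fun_def by (auto simp del: real_scaleR_def)

lemma alt_form_diff:
  fixes \<alpha> \<beta> :: "('v::real_vector, real) form"
  shows "alt_form k \<alpha> \<Longrightarrow> alt_form k \<beta> \<Longrightarrow> alt_form k (\<alpha> - \<beta>)"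
  unfolding alt_form_def by (auto intro: linear_compose_sub)

lemma alt_form_grade_inv:
  fixes \<alpha> :: "('v::real_vector, real) form"
  shows "alt_form k \<alpha> \<Longrightarrow> alt_form k (grade_inv \<alpha>)"
  by (simp add: grade_inv_alt_form alt_form_scaleR)

lemma linear_mult_const:
  fixes f :: "'v::real_vector \<Rightarrow> real"
  assumes "linear f" shows "linear (\<lambda>x. c * f x)" "linear (\<lambda>x. f x * c)"
  using linear_compose_scale_right[OF assms, of c] by (simp_all add: mult.commute)

lemma linear_wedge_left:
  assumes "\<And>ws. linear (\<lambda>x. F x ws :: real)" shows "linear (\<lambda>x. (F x \<^bold>\<and> \<beta>) vs)"
  unfolding wedge_def by (intro linear_compose_sum ballI linear_mult_const assms)

lemma linear_wedge_right:
  assumes "\<And>ws. linear (\<lambda>x. F x ws :: real)" shows "linear (\<lambda>x. (\<alpha> \<^bold>\<and> F x) vs)"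
  unfolding wedge_def by (intro linear_compose_sum ballI linear_mult_const assms)

lemma contract_contract_alt_form:
  "alt_form k \<alpha> \<Longrightarrow> contract x (contract x \<alpha>) = 0"
  by (simp add: fun_eq_iff zero_fun_def alt_formD(5))

text \<open>
  By induction on the total degree: \<open>\<iota>\<^sub>x(\<alpha> \<and> \<beta>)\<close> is a sum of products of lower degree, and in
  \<open>\<iota>\<^sub>x\<iota>\<^sub>x(\<alpha> \<and> \<beta>)\<close> the two mixed terms cancel.
\<close>

lemma alt_form_wedge:
  fixes \<alpha> \<beta> :: "('v::real_vector, real) form"
  assumes "alt_form k \<alpha>" "alt_form l \<beta>"
  shows "alt_form (k + l) (\<alpha> \<^bold>\<and> \<beta>)"
  using assms
proof (induction "k + l" arbitrary: k l \<alpha> \<beta>)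
  case 0
  have "(\<alpha> \<^bold>\<and> \<beta>) (x # vs) = 0" for x vs
    using 0 by (simp add: wedge_Cons contract_alt_form_0 wedge_linear)
  then show ?case
    using 0 by (auto simp: alt_form_0_iff neq_Nil_conv)
next
  case (Suc m)
  have 1: "alt_form m (contract x \<alpha> \<^bold>\<and> \<beta>)" for x
  proof (cases k)
    case 0
    then show ?thesis using Suc.prems by (simp add: contract_alt_form_0 wedge_linear)
  next
    case (Suc k')
    with Suc.prems Suc.hyps(2) show ?thesis
      using Suc.hyps(1)[of k' l "contract x \<alpha>" \<beta>] alt_form_Suc_contract[of k' \<alpha> x] by auto
  qed
  have 2: "alt_form m (grade_inv \<alpha> \<^bold>\<and> contract x \<beta>)" for x
  proof (cases l)
    case 0
    then show ?thesis using Suc.prems by (simp add: contract_alt_form_0 wedge_linear)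
  next
    case (Suc l')
    with Suc.prems Suc.hyps(2) show ?thesis
      using Suc.hyps(1)[of k l' "grade_inv \<alpha>" "contract x \<beta>"] alt_form_Suc_contract[of l' \<beta> x]
      by (auto simp: alt_form_grade_inv)
  qed
  have "alt_form (Suc m) (\<alpha> \<^bold>\<and> \<beta>)"
  proof (rule alt_form_SucI)
    show "(\<alpha> \<^bold>\<and> \<beta>) [] = 0"
      using Suc.hyps(2) alt_formD(1)[OF Suc.prems(1), of "[]"] alt_formD(1)[OF Suc.prems(2), of "[]"]
      by (cases k) auto
    show "alt_form m (contract x (\<alpha> \<^bold>\<and> \<beta>))" for x
      by (simp add: contract_wedge alt_form_add 1 2)
    show "linear (\<lambda>x. (\<alpha> \<^bold>\<and> \<beta>) (x # ws))" for ws
      unfolding wedge_Cons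
      by (intro linear_compose_add linear_wedge_left linear_wedge_right)
        (simp_all add: alt_formD(4)[OF Suc.prems(1)] alt_formD(4)[OF Suc.prems(2)])
    show "(\<alpha> \<^bold>\<and> \<beta>) (x # x # ws) = 0" for x ws
    proof -
      have "contract x (contract x (\<alpha> \<^bold>\<and> \<beta>)) = 0"
        using Suc.prems by (simp add: contract_wedge contract_grade_inv wedge_linear contract_contract_alt_form)
      then show ?thesis by (simp add: fun_eq_iff zero_fun_def)
    qed
  qed
  then show ?case by (simp add: Suc.hyps(2))
qed

section \<open>Cartan calculus for the Chevalley--Eilenberg differential\<close>

text \<open>
  The Lie derivative of a left-invariant form, \<open>(L\<^sub>x\<alpha>)(v\<^sub>1,\<dots>,v\<^sub>k) = -\<Sum>\<^sub>i \<alpha>(v\<^sub>1,\<dots>,[x,v\<^sub>i],\<dots>,v\<^sub>k)\<close>. The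
  recursion is the rule \<open>[L\<^sub>x, \<iota>\<^sub>y] = \<iota>\<^bsub>[x,y]\<^esub>\<close>.
\<close>

fun lie_deriv :: "('v \<Rightarrow> 'v \<Rightarrow> 'v) \<Rightarrow> 'v \<Rightarrow> ('v, real) form \<Rightarrow> ('v, real) form"
  where
    "lie_deriv br x \<alpha> [] = 0"
  | "lie_deriv br x \<alpha> (y # vs) = lie_deriv br x (contract y \<alpha>) vs - \<alpha> (br x y # vs)"

lemma contract_lie_deriv:
  "contract y (lie_deriv br x \<alpha>) = lie_deriv br x (contract y \<alpha>) - contract (br x y) \<alpha>"
  by (simp add: fun_eq_iff)

lemma linear_lie_deriv:
  assumes "\<And>ws. linear (\<lambda>y. F y ws)" shows "linear (\<lambda>y. lie_deriv br x (F y) vs)"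
  using assms
proof (induction vs arbitrary: F)
  case (Cons z vs)
  then show ?case by (auto intro!: linear_compose_sub)
qed (simp add: module_hom_zero)

lemma lie_deriv_add: "lie_deriv br x (\<alpha> + \<beta>) = lie_deriv br x \<alpha> + lie_deriv br x \<beta>"
proof
  show "lie_deriv br x (\<alpha> + \<beta>) vs = (lie_deriv br x \<alpha> + lie_deriv br x \<beta>) vs" for vs
    by (induction vs arbitrary: \<alpha> \<beta>) simp_all
qed

lemma lie_deriv_minus: "lie_deriv br x (- \<alpha>) = - lie_deriv br x \<alpha>"
proof
  have [simp]: "contract y (- \<alpha>) = - contract y \<alpha>" for y and \<alpha> :: "('a, real) form"
    by (simp add: fun_eq_iff)
  show "lie_deriv br x (- \<alpha>) vs = (- lie_deriv br x \<alpha>) vs" for vs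
    by (induction vs arbitrary: \<alpha>) simp_all
qed

lemma lie_deriv_diff: "lie_deriv br x (\<alpha> - \<beta>) = lie_deriv br x \<alpha> - lie_deriv br x \<beta>"
  using lie_deriv_add[of br x \<alpha> "- \<beta>"] by (simp add: lie_deriv_minus)

lemma lie_deriv_zero [simp]: "lie_deriv br x 0 = 0"
  using lie_deriv_add[of br x 0 0] by simp

lemma lie_deriv_grade_inv: "lie_deriv br x (grade_inv \<alpha>) = grade_inv (lie_deriv br x \<alpha>)"
proof
  show "lie_deriv br x (grade_inv \<alpha>) vs = grade_inv (lie_deriv br x \<alpha>) vs" for vs
  proof (induction vs arbitrary: \<alpha>)
    case (Cons y vs)
    have "contract y (lie_deriv br x (grade_inv \<alpha>)) vs = contract y (grade_inv (lie_deriv br x \<alpha>)) vs"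
      unfolding contract_lie_deriv contract_grade_inv
      by (simp add: Cons.IH lie_deriv_minus del: contract_apply)
    then show ?case by (simp del: lie_deriv.simps)
  qed (simp add: grade_inv_def)
qed

lemma lie_deriv_wedge:
  "lie_deriv br x (\<alpha> \<^bold>\<and> \<beta>) = lie_deriv br x \<alpha> \<^bold>\<and> \<beta> + \<alpha> \<^bold>\<and> lie_deriv br x \<beta>"
proof
  show "lie_deriv br x (\<alpha> \<^bold>\<and> \<beta>) vs = (lie_deriv br x \<alpha> \<^bold>\<and> \<beta> + \<alpha> \<^bold>\<and> lie_deriv br x \<beta>) vs" for vs
  proof (induction vs arbitrary: \<alpha> \<beta>)
    case (Cons y vs)
    have "contract y (lie_deriv br x (\<alpha> \<^bold>\<and> \<beta>)) vs
        = contract y (lie_deriv br x \<alpha> \<^bold>\<and> \<beta> + \<alpha> \<^bold>\<and> lie_deriv br x \<beta>) vs"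
      by (simp add: contract_lie_deriv contract_wedge Cons.IH lie_deriv_add lie_deriv_grade_inv
          wedge_linear del: contract_apply)
    then show ?case by (simp del: lie_deriv.simps)
  qed simp
qed

lemma linear_lie_deriv_vector:
  assumes "bilinear br" "alt_form k \<alpha>"
  shows "linear (\<lambda>x. lie_deriv br x \<alpha> vs)"
  using assms(2)
proof (induction vs arbitrary: k \<alpha>)
  case (Cons y vs)
  have "linear (\<lambda>x. \<alpha> (br x y # vs))"
    using linear_compose[OF _ alt_formD(4)[OF Cons.prems, of vs], of "\<lambda>x. br x y"] assms(1)
    by (simp add: bilinear_def o_def)
  with Cons.IH[OF alt_form_contract[OF Cons.prems]] show ?case
    by (auto intro: linear_compose_sub simp del: contract_apply)
qed (simp add: module_hom_zero)

lemma alt_form_lie_deriv: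
  assumes "bilinear br" "alt_form k \<alpha>"
  shows "alt_form k (lie_deriv br x \<alpha>)"
  using assms(2)
proof (induction k arbitrary: \<alpha>)
  case 0
  then show ?case by (auto simp: alt_form_0_iff neq_Nil_conv contract_alt_form_0)
next
  case (Suc k)
  have lin: "linear (\<lambda>y. \<alpha> (br x y # ws))" for ws
    using linear_compose[OF _ alt_formD(4)[OF Suc.prems, of ws], of "br x"] assms(1)
    by (simp add: bilinear_def o_def)
  show ?case
  proof (rule alt_form_SucI)
    show "alt_form k (contract y (lie_deriv br x \<alpha>))" for y
      unfolding contract_lie_deriv
      by (intro alt_form_diff Suc.IH alt_form_Suc_contract Suc.prems)
    show "linear (\<lambda>y. lie_deriv br x \<alpha> (y # ws))" for ws
      unfolding lie_deriv.simps
      by (intro linear_compose_sub linear_lie_deriv lin) (simp add: alt_formD(4)[OF Suc.prems])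
    show "lie_deriv br x \<alpha> (y # y # ws) = 0" for y ws
      using alt_form_swap[OF Suc.prems, of "br x y" y ws]
      by (simp add: contract_contract_alt_form[OF Suc.prems])
  qed simp
qed

text \<open>
  Commuting both sides with \<open>\<iota>\<^sub>z\<close> leaves \<open>\<iota>\<close> of the Jacobi identity as the only extra term.
\<close>

lemma lie_deriv_bracket:
  fixes br :: "'v::real_vector \<Rightarrow> 'v \<Rightarrow> 'v"
  assumes "lie_algebra br" "alt_form k \<alpha>"
  shows "lie_deriv br x (lie_deriv br y \<alpha>) - lie_deriv br y (lie_deriv br x \<alpha>)
    = lie_deriv br (br x y) \<alpha>"
proof
  have bil: "bilinear br" using assms(1) by (simp add: lie_algebra_def)
  have anti: "br y x = - br x y" for x y
  proof -
    have "br (x + y) (x + y) = 0" "br x x = 0" "br y y = 0" using assms(1) by (auto simp: lie_algebra_def)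
    then show ?thesis
      by (simp add: bilinear_ladd[OF bil] bilinear_radd[OF bil] eq_neg_iff_add_eq_0 add.commute)
  qed
  have jac: "br (br x y) z = br x (br y z) - br y (br x z)" for z
  proof -
    have "br x (br y z) + br y (br z x) + br z (br x y) = 0" using assms(1) by (simp add: lie_algebra_def)
    moreover have "br y (br z x) = - br y (br x z)"
      by (subst anti[of z x]) (rule bilinear_rneg[OF bil])
    ultimately show ?thesis using anti[of z "br x y"] by (simp add: algebra_simps)
  qed
  show "(lie_deriv br x (lie_deriv br y \<alpha>) - lie_deriv br y (lie_deriv br x \<alpha>)) vs
    = lie_deriv br (br x y) \<alpha> vs" for vs
    using assms(2)
  proof (induction vs arbitrary: k \<alpha>)
    case (Cons z vs)
    have "\<alpha> (br (br x y) z # vs) = \<alpha> (br x (br y z) # vs) - \<alpha> (br y (br x z) # vs)"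
      unfolding jac by (rule linear_diff[OF alt_formD(4)[OF Cons.prems]])
    then show ?case
      using Cons.IH[OF alt_form_contract[OF Cons.prems], of z]
      by (simp add: contract_lie_deriv lie_deriv_diff del: contract_apply)
  qed simp
qed

lemma ce_diff_linear:
  "ce_diff br (\<alpha> + \<beta>) = ce_diff br \<alpha> + ce_diff br \<beta>"
  "ce_diff br (\<alpha> - \<beta>) = ce_diff br \<alpha> - ce_diff br \<beta>"
  "ce_diff br (- \<alpha>) = - ce_diff br \<alpha>" "ce_diff br 0 = 0"
  "ce_diff br (c *\<^sub>R \<alpha>) = c *\<^sub>R ce_diff br \<alpha>"
  by (auto simp: ce_diff_def fun_eq_iff zero_fun_def scaleR_fun_def algebra_simps sum.distrib
      sum_subtractf sum_negf sum_distrib_left)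

lemma ce_diff_Nil [simp]: "ce_diff br \<alpha> [] = 0"
  by (simp add: ce_diff_def)

lemma linear_ce_diff:
  assumes "\<And>ws. linear (\<lambda>y. F y ws)" shows "linear (\<lambda>y. ce_diff br (F y) vs)"
  unfolding ce_diff_def by (intro linear_compose_sum ballI linear_mult_const assms)

lemma ce_diff_grade_inv: "ce_diff br (grade_inv \<alpha>) = - grade_inv (ce_diff br \<alpha>)"
proof
  fix vs
  have "(- 1) ^ length (br (vs ! i) (vs ! j) # nths vs (- {i, j})) = - ((- 1) ^ length vs :: real)"
    if "i < j" "j < length vs" for i j
  proof -
    have "{m. m < length vs \<and> m \<in> - {i, j}} = {..<length vs} - {i, j}" by auto
    then have "length (nths vs (- {i, j})) = length vs - 2"
      using that by (simp add: length_nths card_Diff_subset)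
    then have "length vs = Suc (length (br (vs ! i) (vs ! j) # nths vs (- {i, j})))" using that by simp
    then show ?thesis by (simp only: power_Suc)
  qed
  then show "ce_diff br (grade_inv \<alpha>) vs = (- grade_inv (ce_diff br \<alpha>)) vs"
    unfolding ce_diff_def grade_inv_def uminus_apply sum_distrib_left sum_negf[symmetric]
    by (intro sum.cong) (simp_all del: list.size)
qed

text \<open>
  Moving \<open>[x,v\<^sub>j]\<close> from position \<open>j\<close> to the front costs \<open>(-1)\<^sup>j\<close>; in this form the Lie
  derivative occurs inside the definition of the differential.
\<close>

lemma lie_deriv_conv_sum:
  assumes "alt_form k \<alpha>"
  shows "lie_deriv br x \<alpha> vs
    = - (\<Sum>j<length vs. (- 1) ^ j * \<alpha> (br x (vs ! j) # nths vs (- {j})))"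
  using assms
proof (induction vs arbitrary: k \<alpha>)
  case (Cons y vs)
  have 0: "nths (y # vs) (- {0}) = vs"
    by (simp add: nths_Cons nths_all)
  have S: "nths (y # vs) (- {Suc j}) = y # nths vs (- {j})" for j
    by (simp add: nths_Cons Compl_eq)
  have "(\<Sum>j<length (y # vs). (- 1) ^ j * \<alpha> (br x ((y # vs) ! j) # nths (y # vs) (- {j})))
    = \<alpha> (br x y # vs) - (\<Sum>j<length vs. (- 1) ^ j * \<alpha> (br x (vs ! j) # y # nths vs (- {j})))"
    unfolding list.size add_Suc_right add_0_right sum.lessThan_Suc_shift nth_Cons_0 nth_Cons_Suc 0 S
    by (simp add: sum_negf)
  also have "(\<Sum>j<length vs. (- 1) ^ j * \<alpha> (br x (vs ! j) # y # nths vs (- {j})))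
    = lie_deriv br x (contract y \<alpha>) vs"
    unfolding Cons.IH[OF alt_form_contract[OF Cons.prems]]
    by (subst alt_form_swap[OF Cons.prems]) (simp add: sum_negf)
  finally show ?case by simp
qed simp

text \<open>
  Cartan's formula \<open>\<iota>\<^sub>xd = L\<^sub>x - d\<iota>\<^sub>x\<close>: the brackets that involve \<open>x\<close> add up to the Lie derivative, and
  in the others \<open>x\<close> is swapped with the bracket in front of it, which produces \<open>-d\<iota>\<^sub>x\<close>. It gives
  the differential a recursive description, which the rest of the section uses in place of the
  double sum.
\<close>

lemma contract_ce_diff:
  assumes "alt_form k \<alpha>"
  shows "contract x (ce_diff br \<alpha>) = lie_deriv br x \<alpha> - ce_diff br (contract x \<alpha>)"
proof
  fix vs
  have 0: "nths (x # vs) (- {0, Suc j}) = nths vs (- {j})" for j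
    by (simp add: nths_Cons Compl_eq)
  have S: "nths (x # vs) (- {Suc i, Suc j}) = x # nths vs (- {i, j})" for i j
    by (simp add: nths_Cons Compl_eq)
  have "contract x (ce_diff br \<alpha>) vs
    = (\<Sum>j<length vs. - ((- 1) ^ j * \<alpha> (br x (vs ! j) # nths vs (- {j})))
      + (\<Sum>i<j. (- 1) ^ (i + j) * \<alpha> (br (vs ! i) (vs ! j) # x # nths vs (- {i, j}))))"
    unfolding contract_apply ce_diff_def list.size add_Suc_right add_0_right
      sum.lessThan_Suc_shift nth_Cons_0 nth_Cons_Suc 0 S
    by simp
  also have "\<dots> = lie_deriv br x \<alpha> vs
      + (\<Sum>j<length vs. \<Sum>i<j. (- 1) ^ (i + j) * \<alpha> (br (vs ! i) (vs ! j) # x # nths vs (- {i, j})))"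
    unfolding sum.distrib sum_negf lie_deriv_conv_sum[OF assms] ..
  also have "(\<Sum>j<length vs. \<Sum>i<j. (- 1) ^ (i + j) * \<alpha> (br (vs ! i) (vs ! j) # x # nths vs (- {i, j})))
    = - ce_diff br (contract x \<alpha>) vs"
    unfolding ce_diff_def by (subst alt_form_swap[OF assms]) (simp add: sum_negf)
  finally show "contract x (ce_diff br \<alpha>) vs = (lie_deriv br x \<alpha> - ce_diff br (contract x \<alpha>)) vs"
    by simp
qed

text \<open>
  By Cartan's formula, \<open>\<iota>\<^sub>xd\<alpha>\<close> is alternating by induction on the degree, and
  \<open>\<iota>\<^sub>x\<iota>\<^sub>xd\<alpha> = L\<^sub>x\<iota>\<^sub>x\<alpha> - \<iota>\<^bsub>[x,x]\<^esub>\<alpha> - L\<^sub>x\<iota>\<^sub>x\<alpha> + d\<iota>\<^sub>x\<iota>\<^sub>x\<alpha> = 0\<close>.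
\<close>

lemma alt_form_ce_diff:
  assumes "lie_algebra br" "alt_form k \<alpha>"
  shows "alt_form (Suc k) (ce_diff br \<alpha>)"
  using assms(2)
proof (induction k arbitrary: \<alpha> rule: less_induct)
  case (less k)
  have bil: "bilinear br" and self: "br x x = 0" for x using assms(1) by (simp_all add: lie_algebra_def)
  note cd = contract_ce_diff[OF less.prems]
  have sub: "alt_form k (ce_diff br (contract x \<alpha>))" for x
  proof (cases k)
    case 0
    then show ?thesis using less.prems by (simp add: contract_alt_form_0 ce_diff_linear)
  next
    case (Suc l)
    then show ?thesis
      using less.IH[of l "contract x \<alpha>"] less.prems alt_form_Suc_contract[of l \<alpha> x] by (simp del: contract_apply)
  qed
  show ?case
  proof (rule alt_form_SucI)
    show "alt_form k (contract x (ce_diff br \<alpha>))" for x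
      unfolding cd by (intro alt_form_diff alt_form_lie_deriv bil less.prems sub)
    have "linear (\<lambda>x. contract x (ce_diff br \<alpha>) ws)" for ws
      unfolding cd fun_diff_def
      by (intro linear_compose_sub linear_lie_deriv_vector[OF bil less.prems] linear_ce_diff)
        (simp add: alt_formD(4)[OF less.prems])
    then show "linear (\<lambda>x. ce_diff br \<alpha> (x # ws))" for ws by simp
    have "contract x (contract x (ce_diff br \<alpha>)) = 0" for x
    proof -
      have "contract 0 \<alpha> = 0"
        using linear_0[OF alt_formD(4)[OF less.prems]] by (simp add: fun_eq_iff zero_fun_def)
      then show ?thesis
        by (simp add: cd contract_lie_deriv contract_ce_diff[OF alt_form_contract[OF less.prems]]
            contract_contract_alt_form[OF less.prems] self ce_diff_linear)
    qed
    then show "ce_diff br \<alpha> (x # x # ws) = 0" for x ws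
      by (simp add: fun_eq_iff zero_fun_def)
  qed simp
qed

text \<open>
  Applying \<open>\<iota>\<^sub>y\<close> to \<open>[L\<^sub>x,d]\<alpha>\<close> gives \<open>([L\<^sub>x,L\<^sub>y] - L\<^bsub>[x,y]\<^esub>)\<alpha> - [L\<^sub>x,d]\<iota>\<^sub>y\<alpha>\<close>. The first part is zero by
  the Jacobi identity, the second by induction.
\<close>

lemma lie_deriv_ce_diff:
  assumes "lie_algebra br" "alt_form k \<alpha>"
  shows "lie_deriv br x (ce_diff br \<alpha>) = ce_diff br (lie_deriv br x \<alpha>)"
proof
  have bil: "bilinear br" using assms(1) by (simp add: lie_algebra_def)
  show "lie_deriv br x (ce_diff br \<alpha>) vs = ce_diff br (lie_deriv br x \<alpha>) vs" for vs
    using assms(2)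
  proof (induction vs arbitrary: k \<alpha>)
    case (Cons y vs)
    have alt: "alt_form k (lie_deriv br x \<alpha>)" by (rule alt_form_lie_deriv[OF bil Cons.prems])
    have "contract y (lie_deriv br x (ce_diff br \<alpha>)) vs = contract y (ce_diff br (lie_deriv br x \<alpha>)) vs"
      using fun_cong[OF lie_deriv_bracket[OF assms(1) Cons.prems, of x y], of vs]
      by (simp add: contract_lie_deriv contract_ce_diff[OF Cons.prems] contract_ce_diff[OF alt]
          lie_deriv_diff ce_diff_linear Cons.IH[OF alt_form_contract[OF Cons.prems]] del: contract_apply)
    then show ?case by (simp del: lie_deriv.simps)
  qed simp
qed

text \<open>
  \<open>\<iota>\<^sub>xdd\<alpha> = L\<^sub>xd\<alpha> - dL\<^sub>x\<alpha> + dd\<iota>\<^sub>x\<alpha>\<close> by using Cartan's formula twice.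
\<close>

lemma ce_diff_ce_diff:
  assumes "lie_algebra br" "alt_form k \<alpha>"
  shows "ce_diff br (ce_diff br \<alpha>) = 0"
proof
  show "ce_diff br (ce_diff br \<alpha>) vs = 0 vs" for vs
    using assms(2)
  proof (induction vs arbitrary: k \<alpha>)
    case (Cons x vs)
    have "contract x (ce_diff br (ce_diff br \<alpha>)) vs = 0"
      using Cons.IH[OF alt_form_contract[OF Cons.prems]]
      by (simp add: contract_ce_diff[OF alt_form_ce_diff[OF assms(1) Cons.prems]] contract_ce_diff[OF Cons.prems]
          lie_deriv_ce_diff[OF assms(1) Cons.prems] ce_diff_linear zero_fun_def del: contract_apply)
    then show ?case by (simp add: zero_fun_def)
  qed (simp add: zero_fun_def)
qed

text \<open>
  The graded Leibniz rule. Applying \<open>\<iota>\<^sub>x\<close> to both sides and using Cartan's formula, the Lie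
  derivative terms match because \<open>L\<^sub>x\<close> is a derivation, and the others by induction.
\<close>

lemma ce_diff_wedge:
  assumes "alt_form k \<alpha>" "alt_form l \<beta>"
  shows "ce_diff br (\<alpha> \<^bold>\<and> \<beta>) = ce_diff br \<alpha> \<^bold>\<and> \<beta> + grade_inv \<alpha> \<^bold>\<and> ce_diff br \<beta>"
proof
  show "ce_diff br (\<alpha> \<^bold>\<and> \<beta>) vs = (ce_diff br \<alpha> \<^bold>\<and> \<beta> + grade_inv \<alpha> \<^bold>\<and> ce_diff br \<beta>) vs" for vs
    using assms
  proof (induction vs arbitrary: k l \<alpha> \<beta>)
    case (Cons x vs)
    note 1 = Cons.prems
    note IH1 = Cons.IH[OF alt_form_contract[OF 1(1)] 1(2), of x]
    note IH2 = Cons.IH[OF alt_form_grade_inv[OF 1(1)] alt_form_contract[OF 1(2)], of x,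
        unfolded ce_diff_grade_inv wedge_linear grade_inv_simps]
    have "contract x (ce_diff br (\<alpha> \<^bold>\<and> \<beta>)) vs
        = contract x (ce_diff br \<alpha> \<^bold>\<and> \<beta> + grade_inv \<alpha> \<^bold>\<and> ce_diff br \<beta>) vs"
      by (simp add: contract_ce_diff[OF alt_form_wedge[OF 1]] contract_ce_diff[OF 1(1)] contract_ce_diff[OF 1(2)]
         contract_wedge contract_grade_inv lie_deriv_wedge wedge_linear ce_diff_linear IH1 IH2
         del: contract_apply)
    then show ?case by simp
  qed simp
qed

section \<open>Dual frames and the Hodge star\<close>

definition one_form :: "('v \<Rightarrow> real) \<Rightarrow> ('v, real) form"
  where "one_form f vs = (if length vs = 1 then f (hd vs) else 0)"

lemma alt_form_one_form:
  assumes "linear f" shows "alt_form 1 (one_form f)"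
proof -
  have "linear (\<lambda>x. one_form f (us @ x # ws))" for us ws
    using assms by (cases "us = [] \<and> ws = []") (auto simp: one_form_def module_hom_zero)
  moreover have "one_form f vs = 0" if "\<not> distinct vs" for vs
    using that by (cases vs rule: list.exhaust[case_product list.exhaust[of "tl vs"]]) (auto simp: one_form_def)
  ultimately show ?thesis by (auto simp: alt_form_def one_form_def)
qed

lemma one_form_eqI:
  assumes "alt_form 1 \<alpha>" "alt_form 1 \<beta>" "\<And>x. \<alpha> [x] = \<beta> [x]"
  shows "\<alpha> = \<beta>"
proof
  show "\<alpha> vs = \<beta> vs" for vs
    using assms(3) alt_formD(1)[OF assms(1), of vs] alt_formD(1)[OF assms(2), of vs]
    by (cases "length vs = 1") (auto simp: length_Suc_conv)
qed

lemma linear_one_form: "alt_form 1 \<alpha> \<Longrightarrow> linear (\<lambda>x. \<alpha> [x])"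
  by (rule alt_formD(4))

lemma alt_form_sum:
  fixes f :: "'i \<Rightarrow> ('v::real_vector, real) form"
  shows "(\<And>i. i \<in> A \<Longrightarrow> alt_form k (f i)) \<Longrightarrow> alt_form k (sum f A)"
  by (induction A rule: infinite_finite_induct) (auto intro: alt_form_add)

lemma sum_form_apply:
  fixes f :: "'i \<Rightarrow> ('v, real) form" shows "sum f A vs = (\<Sum>i\<in>A. f i vs)"
  by (induction A rule: infinite_finite_induct) (auto simp: zero_fun_def)

lemma scaleR_form_apply [simp]: "(c *\<^sub>R \<alpha>) vs = c * (\<alpha> :: ('v, real) form) vs"
  by (simp add: scaleR_fun_def)

text \<open>
  Induction on the number of forms. Given vectors dual to the forms indexed by \<open>I\<close>, independence
  yields a vector \<open>w\<close> on which \<open>e a\<close> differs from its would-be expansion in the other forms;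
  removing from \<open>w\<close> its components along the dual vectors and rescaling gives the vector dual to
  \<open>e a\<close>, and the old vectors are corrected by multiples of it. \<close>

lemma exists_dual_vectors:
  fixes e :: "'i \<Rightarrow> ('v::real_vector, real) form"
  assumes "finite I" "inj_on e I" "independent (e ` I)" "\<And>i. i \<in> I \<Longrightarrow> alt_form 1 (e i)"
  shows "\<exists>E. \<forall>i\<in>I. \<forall>j\<in>I. e i [E j] = (if i = j then 1 else 0)"
  using assms
proof (induction I)
  case (insert a I)
  have "e a \<notin> e ` I" using insert.hyps(2) insert.prems(1) by auto
  then have ind: "independent (e ` I)" "e a \<notin> span (e ` I)"
    using insert.prems(2) by (simp_all add: independent_insert)
  with insert.IH insert.prems obtain E where
    E: "\<And>i j. i \<in> I \<Longrightarrow> j \<in> I \<Longrightarrow> e i [E j] = (if i = j then 1 else 0)" by auto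
  have lin: "linear (\<lambda>x. e i [x])" if "i \<in> insert a I" for i
    using insert.prems(3)[OF that] by (rule linear_one_form)
  define r where "r w = e a [w] - (\<Sum>j\<in>I. e j [w] * e a [E j])" for w
  obtain w where w: "r w \<noteq> 0"
  proof (rule ccontr)
    assume "\<not> thesis"
    with that have r0: "r w = 0" for w by blast
    have eq: "e a [w] = (\<Sum>j\<in>I. e a [E j] * e j [w])" for w
      using r0[of w] by (simp add: r_def mult.commute)
    have "e a = (\<Sum>j\<in>I. e a [E j] *\<^sub>R e j)"
    proof (rule one_form_eqI)
      show "alt_form 1 (\<Sum>j\<in>I. e a [E j] *\<^sub>R e j)"
        by (intro alt_form_sum alt_form_scaleR insert.prems(3)) simp
      show "e a [x] = (\<Sum>j\<in>I. e a [E j] *\<^sub>R e j) [x]" for x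
        unfolding sum_form_apply scaleR_form_apply by (rule eq)
    qed (rule insert.prems(3)[OF insertI1])
    also have "\<dots> \<in> span (e ` I)" by (intro span_sum span_scale span_base imageI)
    finally show False using ind(2) by simp
  qed
  (* The vector dual to e a; the e j with j in I vanish on it. *)
  define u where "u = (1 / r w) *\<^sub>R (w - (\<Sum>j\<in>I. e j [w] *\<^sub>R E j))"
  have e_u: "e i [u] = (1 / r w) * (e i [w] - (\<Sum>j\<in>I. e j [w] * e i [E j]))" if "i \<in> insert a I" for i
    unfolding u_def linear_cmul[OF lin[OF that]] linear_diff[OF lin[OF that]] linear_sum[OF lin[OF that]]
    by simp
  have u: "e a [u] = 1" using w by (simp add: e_u r_def)
  have u0: "e i [u] = 0" if "i \<in> I" for i
  proof -
    have "(\<Sum>j\<in>I. e j [w] * e i [E j]) = (\<Sum>j\<in>I. if j = i then e j [w] else 0)"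
      using that by (intro sum.cong) (auto simp: E)
    then show ?thesis using that insert.hyps(1) by (simp add: e_u)
  qed
  (* Only the value of e a on the old vectors has to be corrected, since u is invisible to the others. *)
  define E' where "E' j = (if j = a then u else E j - e a [E j] *\<^sub>R u)" for j
  have "e i [E' j] = (if i = j then 1 else 0)" if "i \<in> insert a I" "j \<in> insert a I" for i j
  proof -
    have "e i [E j - e a [E j] *\<^sub>R u] = e i [E j] - e a [E j] * e i [u]"
      unfolding linear_diff[OF lin[OF that(1)]] linear_cmul[OF lin[OF that(1)]] by simp
    then show ?thesis
      using that insert.hyps(2) by (auto simp: E'_def u u0 E)
  qed
  then show ?case by blast
qed simp

lemma coframe_alt_form:
  assumes "coframe n e" "i \<in> {1..n}" shows "alt_form 1 (e i)"
proof -
  have "e i \<in> span (e ` {1..n})" using assms(2) by (intro span_base imageI)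
  then show ?thesis using assms(1) by (simp add: coframe_def)
qed

text \<open>
  A nonzero vector \<open>u\<close> would be seen by some linear functional, hence by some member of the coframe.
  This makes the dual frame unique.
\<close>

lemma coframe_separates:
  fixes e :: "nat \<Rightarrow> ('v::real_vector, real) form"
  assumes "coframe n e" "\<And>i. i \<in> {1..n} \<Longrightarrow> e i [u] = 0"
  shows "u = 0"
proof (rule ccontr)
  assume "u \<noteq> 0"
  then have "independent {u}" by simp
  then obtain f :: "'v \<Rightarrow> real" where f: "linear f" "f u = 1"
    using linear_independent_extend[of "{u}" "\<lambda>_. 1"] by auto
  then have "one_form f \<in> span (e ` {1..n})"
    using assms(1) alt_form_one_form[OF f(1)] by (simp add: coframe_def)
  then have "one_form f [u] = 0"
    by (induction rule: span_induct_alt) (use assms(2) in \<open>auto simp: zero_fun_def\<close>)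
  then show False using f(2) by (simp add: one_form_def)
qed

lemma dual_frame:
  fixes e :: "nat \<Rightarrow> ('v::real_vector, real) form"
  assumes "coframe n e" "i \<in> {1..n}" "j \<in> {1..n}"
  shows "e i [dual_frame n e j] = (if i = j then 1 else 0)"
proof -
  obtain E where E: "\<forall>i\<in>{1..n}. \<forall>j\<in>{1..n}. e i [E j] = (if i = j then 1 else 0)"
    using exists_dual_vectors[of "{1..n}" e] assms(1) coframe_alt_form[OF assms(1)]
    by (auto simp: coframe_def)
  have "\<exists>!v. \<forall>i\<in>{1..n}. e i [v] = (if i = j then 1 else 0)"
  proof (rule ex1I[of _ "E j"])
    show "\<forall>i\<in>{1..n}. e i [E j] = (if i = j then 1 else 0)" using E assms(3) by blast
    fix v assume v: "\<forall>i\<in>{1..n}. e i [v] = (if i = j then 1 else 0)"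
    have "v - E j = 0"
    proof (rule coframe_separates[OF assms(1)])
      fix i assume i: "i \<in> {1..n}"
      then show "e i [v - E j] = 0"
        using v E assms(3) linear_diff[OF linear_one_form[OF coframe_alt_form[OF assms(1) i]], of v "E j"]
        by simp
    qed
    then show "v = E j" by simp
  qed
  from theI'[OF this] assms(2) show ?thesis unfolding dual_frame_def by blast
qed

context
  fixes n :: nat and e :: "nat \<Rightarrow> ('v::real_vector, real) form"
  assumes cof: "coframe n e"
begin

lemma contract_dual_frame:
  assumes "i \<in> {1..n}" "j \<in> {1..n}"
  shows "contract (dual_frame n e j) (e i) = (if i = j then unit_form else 0)"
  using contract_one_form[OF coframe_alt_form[OF cof assms(1)]] by (simp add: dual_frame[OF cof assms])

lemma wedge_dual_frame_eq_0:
  assumes "i \<in> {1..n}" "set js \<subseteq> {1..n}" "i \<notin> set js"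
  shows "(e i \<^bold>\<and> \<beta>) (map (dual_frame n e) js) = 0"
  using assms(2,3)
proof (induction js arbitrary: \<beta>)
  case Nil
  then show ?case by (simp add: alt_formD(1)[OF coframe_alt_form[OF cof assms(1)]])
next
  case (Cons j js)
  then show ?case
    using assms(1)
    by (simp add: wedge_Cons contract_dual_frame grade_inv_one_form[OF coframe_alt_form[OF cof assms(1)]]
        wedge_linear del: contract_apply)
qed

lemma contract_foldr_wedge_eq_0:
  assumes "j \<in> {1..n}" "set is \<subseteq> {1..n}" "j \<notin> set is"
  shows "contract (dual_frame n e j) (foldr (\<^bold>\<and>) (map e is) unit_form) = 0"
  using assms(2,3)
proof (induction "is")
  case (Cons i "is")
  then have "contract (dual_frame n e j) (e i) = 0"
    using contract_dual_frame[OF _ assms(1), of i] by auto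
  moreover have "contract (dual_frame n e j) (foldr (\<^bold>\<and>) (map e is) unit_form) = 0"
    by (rule Cons.IH) (use Cons.prems in auto)
  ultimately show ?case by (simp only: list.map foldr.simps o_apply contract_wedge wedge_linear add_0)
qed simp

text \<open>
  The monomials \<open>e\<^sup>I\<close> are dual to the multivectors \<open>E\<^sub>J\<close>. Compare the smallest indices \<open>i\<close> and
  \<open>j\<close>. If \<open>i\<close> is missing from \<open>J\<close>, no argument can be fed to \<open>e\<^sup>i\<close>; if it is present but not
  smallest, then \<open>j < i\<close> is missing from \<open>I\<close> and contraction with \<open>E\<^sub>j\<close> kills the monomial; if
  \<open>i = j\<close>, contraction with \<open>E\<^sub>j\<close> removes \<open>e\<^sup>i\<close> from both.
\<close>

lemma foldr_wedge_dual_frame: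
  assumes "sorted_wrt (<) is" "sorted_wrt (<) js" "set is \<subseteq> {1..n}" "set js \<subseteq> {1..n}"
  shows "foldr (\<^bold>\<and>) (map e is) unit_form (map (dual_frame n e) js) = (if is = js then 1 else 0)"
  using assms
proof (induction "is" arbitrary: js)
  case Nil
  then show ?case by (simp add: unit_form_def)
next
  case (Cons i "is")
  let ?W = "\<lambda>is. foldr (\<^bold>\<and>) (map e is) unit_form"
  show ?case
  proof (cases "i \<in> set js")
    case False
    then show ?thesis using Cons.prems wedge_dual_frame_eq_0[of i js "?W is"] by auto
  next
    case True
    then obtain j js' where js: "js = j # js'" by (cases js) auto
    have i: "i \<in> {1..n}" and j: "j \<in> {1..n}" and isn: "set is \<subseteq> {1..n}" using Cons.prems js by auto
    have *: "?W (i # is) (map (dual_frame n e) js)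
        = contract (dual_frame n e j) (?W (i # is)) (map (dual_frame n e) js')"
      by (simp add: js)
    show ?thesis
    proof (cases "i = j")
      case True
      then have "j \<notin> set is" using Cons.prems(1) by auto
      then have "contract (dual_frame n e j) (?W (i # is)) = ?W is"
        using contract_foldr_wedge_eq_0[OF j isn]
        by (simp add: contract_wedge contract_dual_frame[OF j j] True wedge_linear)
      then show ?thesis using * Cons.IH[of js'] Cons.prems js True by simp
    next
      case False
      then have "j < i" using True Cons.prems(2) js by auto
      then have "j \<notin> set (i # is)" using Cons.prems(1) by auto
      then show ?thesis
        using * contract_foldr_wedge_eq_0[OF j, of "i # is"] Cons.prems(3) js False
        by (simp del: contract_apply)
    qed
  qed
qed

lemma hodge_star_wedge_set:
  assumes "I \<subseteq> {1..n}"
  shows "hodge_star n e (wedge_set e I) = shuffle_sign I ({1..n} - I) *\<^sub>R wedge_set e ({1..n} - I)"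
proof -
  have coeff: "wedge_set e I (map (dual_frame n e) (sorted_list_of_set J)) = (if J = I then 1 else 0)"
    if "J \<in> Pow {1..n}" for J
  proof -
    have fin: "finite I" "finite J" using assms that finite_subset by auto
    then have "sorted_list_of_set I = sorted_list_of_set J \<longleftrightarrow> J = I"
      by (metis set_sorted_list_of_set)
    then show ?thesis
      using foldr_wedge_dual_frame[of "sorted_list_of_set I" "sorted_list_of_set J"] assms that fin
      by (simp add: wedge_set_def)
  qed
  have "hodge_star n e (wedge_set e I) = (\<Sum>J\<in>Pow {1..n}. if J = I then
      shuffle_sign I ({1..n} - I) *\<^sub>R wedge_set e ({1..n} - I) else 0)"
    unfolding hodge_star_def by (intro sum.cong) (auto simp: coeff)
  then show ?thesis using assms by simp
qed

end

lemma hodge_star_linear: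
  "hodge_star n e (\<alpha> + \<beta>) = hodge_star n e \<alpha> + hodge_star n e \<beta>"
  "hodge_star n e (\<alpha> - \<beta>) = hodge_star n e \<alpha> - hodge_star n e \<beta>"
  by (simp_all add: hodge_star_def algebra_simps sum.distrib sum_subtractf)

text \<open>
  The form in which the sign of two explicit index sets can be evaluated by simplification.
\<close>

lemma shuffle_sign_conv_prod:
  assumes "finite A" "finite B"
  shows "shuffle_sign A B = (\<Prod>a\<in>A. \<Prod>b\<in>B. if b < a then - 1 else 1 :: real)"
proof -
  have "(\<Prod>a\<in>A. \<Prod>b\<in>B. if b < a then - 1 else 1 :: real) = (\<Prod>p\<in>A \<times> B. if snd p < fst p then - 1 else 1)"
    by (simp add: prod.cartesian_product case_prod_beta)
  also have "\<dots> = (- 1) ^ card {p \<in> A \<times> B. snd p < fst p}"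
    using assms by (simp add: prod.If_cases Int_def)
  also have "{p \<in> A \<times> B. snd p < fst p} = {(a, b). a \<in> A \<and> b \<in> B \<and> b < a}" by auto
  finally show ?thesis by (simp add: shuffle_sign_def)
qed

section \<open>Adapted coframes of G2- and SU(3)-structures\<close>

text \<open>
  The monomials free of \<open>e\<^sup>7\<close> on the right form \<open>\<omega> \<and> \<omega> / 2\<close>, and the others \<open>\<psi>\<^sub>- \<and> e\<^sup>7\<close>, for the
  SU(3)-structure with coframe \<open>e\<^sup>1, \<dots>, e\<^sup>6\<close>.
\<close>

lemma hodge_star_g2:
  assumes "coframe 7 e"
  shows "hodge_star 7 e (e 1 \<^bold>\<and> e 2 \<^bold>\<and> e 7 + e 3 \<^bold>\<and> e 4 \<^bold>\<and> e 7 + e 5 \<^bold>\<and> e 6 \<^bold>\<and> e 7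
      + e 1 \<^bold>\<and> e 3 \<^bold>\<and> e 5 - e 1 \<^bold>\<and> e 4 \<^bold>\<and> e 6 - e 2 \<^bold>\<and> e 3 \<^bold>\<and> e 6 - e 2 \<^bold>\<and> e 4 \<^bold>\<and> e 5)
    = (e 3 \<^bold>\<and> e 4 \<^bold>\<and> e 5 \<^bold>\<and> e 6 + e 1 \<^bold>\<and> e 2 \<^bold>\<and> e 5 \<^bold>\<and> e 6 + e 1 \<^bold>\<and> e 2 \<^bold>\<and> e 3 \<^bold>\<and> e 4)
      + (e 1 \<^bold>\<and> e 3 \<^bold>\<and> e 6 \<^bold>\<and> e 7 + e 1 \<^bold>\<and> e 4 \<^bold>\<and> e 5 \<^bold>\<and> e 7 + e 2 \<^bold>\<and> e 3 \<^bold>\<and> e 5 \<^bold>\<and> e 7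
        - e 2 \<^bold>\<and> e 4 \<^bold>\<and> e 6 \<^bold>\<and> e 7)"
proof -
  have seven: "{1..7} = {1, 2, 3, 4, 5, 6, 7::nat}" by auto
  note star = hodge_star_wedge_set[OF assms, unfolded seven]
  note simps = wedge_set_def shuffle_sign_conv_prod insert_Diff_if
  have "hodge_star 7 e (e 1 \<^bold>\<and> e 2 \<^bold>\<and> e 7) = e 3 \<^bold>\<and> e 4 \<^bold>\<and> e 5 \<^bold>\<and> e 6"
    using star[of "{1, 2, 7}"] by (simp add: simps)
  moreover have "hodge_star 7 e (e 3 \<^bold>\<and> e 4 \<^bold>\<and> e 7) = e 1 \<^bold>\<and> e 2 \<^bold>\<and> e 5 \<^bold>\<and> e 6"
    using star[of "{3, 4, 7}"] by (simp add: simps)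
  moreover have "hodge_star 7 e (e 5 \<^bold>\<and> e 6 \<^bold>\<and> e 7) = e 1 \<^bold>\<and> e 2 \<^bold>\<and> e 3 \<^bold>\<and> e 4"
    using star[of "{5, 6, 7}"] by (simp add: simps)
  moreover have "hodge_star 7 e (e 1 \<^bold>\<and> e 3 \<^bold>\<and> e 5) = - (e 2 \<^bold>\<and> e 4 \<^bold>\<and> e 6 \<^bold>\<and> e 7)"
    using star[of "{1, 3, 5}"] by (simp add: simps)
  moreover have "hodge_star 7 e (e 1 \<^bold>\<and> e 4 \<^bold>\<and> e 6) = - (e 2 \<^bold>\<and> e 3 \<^bold>\<and> e 5 \<^bold>\<and> e 7)"
    using star[of "{1, 4, 6}"] by (simp add: simps)
  moreover have "hodge_star 7 e (e 2 \<^bold>\<and> e 3 \<^bold>\<and> e 6) = - (e 1 \<^bold>\<and> e 4 \<^bold>\<and> e 5 \<^bold>\<and> e 7)"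
    using star[of "{2, 3, 6}"] by (simp add: simps)
  moreover have "hodge_star 7 e (e 2 \<^bold>\<and> e 4 \<^bold>\<and> e 5) = - (e 1 \<^bold>\<and> e 3 \<^bold>\<and> e 6 \<^bold>\<and> e 7)"
    using star[of "{2, 4, 5}"] by (simp add: simps)
  ultimately show ?thesis by (simp add: hodge_star_linear)
qed

text \<open>
  The 1-forms on \<open>V \<oplus> \<real>\<close> that vanish on the second summand are the pullbacks of those on \<open>V\<close>. As
  \<open>\<theta>\<close> takes the value 1 on its generator \<open>X\<close>, it is not among them, and every 1-form \<open>\<alpha>\<close> becomes
  one of them after subtracting \<open>\<alpha>(X) \<theta>\<close>.
\<close>

lemma coframe_extend:
  fixes e :: "nat \<Rightarrow> ('v::real_vector, real) form" and \<theta> :: "('v \<times> real, real) form"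
  assumes "coframe n e" "alt_form 1 \<theta>" "\<theta> [(0, 1)] = 1"
  shows "coframe (Suc n) ((pullback fst \<circ> e)(Suc n := \<theta>))"
proof -
  let ?P = "pullback fst :: ('v, real) form \<Rightarrow> ('v \<times> real, real) form"
  let ?S = "?P ` e ` {1..n}"
  have linP: "linear ?P" by (rule linearI) (simp_all add: pullback_linear)
  have inj: "inj ?P"
  proof (rule injI)
    fix \<alpha> \<beta> assume "?P \<alpha> = ?P \<beta>"
    (* v \<mapsto> (v, 0) is a section of fst. *)
    then have "?P \<alpha> (map (\<lambda>v. (v, 0)) vs) = ?P \<beta> (map (\<lambda>v. (v, 0)) vs)" for vs by simp
    then show "\<alpha> = \<beta>" by (simp add: pullback_def o_def fun_eq_iff)
  qed
  have span: "span (e ` {1..n}) = {\<alpha>. alt_form 1 \<alpha>}" and ind: "independent (e ` {1..n})"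
    and inj_e: "inj_on e {1..n}"
    using assms(1) by (simp_all add: coframe_def)
  have spanP: "span ?S = ?P ` {\<alpha>. alt_form 1 \<alpha>}"
    unfolding linear_span_image[OF linP] span ..
  have \<theta>_notin: "\<theta> \<notin> span ?S"
  proof
    assume "\<theta> \<in> span ?S"
    then obtain \<alpha> :: "('v, real) form" where \<alpha>: "alt_form 1 \<alpha>" "\<theta> = ?P \<alpha>" unfolding spanP by blast
    then show False
      using assms(3) linear_0[OF linear_one_form[OF \<alpha>(1)]] by (simp add: pullback_def)
  qed
  have "independent ?S"
    by (rule linear_independent_injective_image[OF linP ind inj_on_subset[OF inj]]) simp
  with \<theta>_notin have ind': "independent (insert \<theta> ?S)" by (rule independent_insertI)
  have im: "((?P \<circ> e)(Suc n := \<theta>)) ` {1..Suc n} = insert \<theta> ?S"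
    by (auto simp: atLeastAtMostSuc_conv image_image)
  have "span (insert \<theta> ?S) = {\<alpha>. alt_form 1 \<alpha>}"
  proof (intro subset_antisym span_minimal)
    show "insert \<theta> ?S \<subseteq> {\<alpha>. alt_form 1 \<alpha>}"
      using assms(2) coframe_alt_form[OF assms(1)]
      by (auto simp del: One_nat_def intro!: alt_form_pullback[OF linear_fst])
    show "subspace {\<alpha> :: ('v \<times> real, real) form. alt_form 1 \<alpha>}"
      by (auto simp: subspace_def alt_form_add alt_form_scaleR)
    show "{\<alpha>. alt_form 1 \<alpha>} \<subseteq> span (insert \<theta> ?S)"
    proof
      fix \<alpha> :: "('v \<times> real, real) form"
      assume "\<alpha> \<in> {\<alpha>. alt_form 1 \<alpha>}"
      then have \<alpha>: "alt_form 1 \<alpha>" by simp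
      define \<beta> where "\<beta> = \<alpha> - \<alpha> [(0, 1)] *\<^sub>R \<theta>"
      have \<beta>: "alt_form 1 \<beta>" unfolding \<beta>_def by (intro alt_form_diff alt_form_scaleR \<alpha> assms(2))
      have lin: "linear (\<lambda>v. (v, 0::real))" by (intro linearI) auto
      have "linear (\<lambda>v. \<beta> [(v, 0)])"
        using linear_compose[OF lin linear_one_form[OF \<beta>]] by (simp add: o_def)
      then have o: "alt_form 1 (one_form (\<lambda>v. \<beta> [(v, 0)]))" by (rule alt_form_one_form)
      have "\<beta> = ?P (one_form (\<lambda>v. \<beta> [(v, 0)]))"
      proof (rule one_form_eqI[OF \<beta> alt_form_pullback[OF linear_fst o]])
        fix p :: "'v \<times> real"
        have "\<beta> [(0, 1)] = 0" by (simp add: \<beta>_def assms(3))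
        then have "\<beta> [(fst p, 0) + snd p *\<^sub>R (0, 1)] = \<beta> [(fst p, 0)]"
          unfolding linear_add[OF linear_one_form[OF \<beta>]] linear_cmul[OF linear_one_form[OF \<beta>]] by simp
        then show "\<beta> [p] = ?P (one_form (\<lambda>v. \<beta> [(v, 0)])) [p]"
          by (simp add: pullback_def one_form_def)
      qed
      then have "\<beta> \<in> span ?S" unfolding spanP using o by blast
      then have "\<beta> + \<alpha> [(0, 1)] *\<^sub>R \<theta> \<in> span (insert \<theta> ?S)"
        by (intro span_add span_scale) (auto intro: span_base span_mono[THEN subsetD, of ?S])
      then show "\<alpha> \<in> span (insert \<theta> ?S)" by (simp add: \<beta>_def)
    qed
  qed
  moreover have "inj_on ((?P \<circ> e)(Suc n := \<theta>)) {1..Suc n}"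
  proof -
    have "inj_on (?P \<circ> e) {1..n}"
      using inj_e inj by (simp add: comp_inj_on inj_on_subset)
    then have "inj_on ((?P \<circ> e)(Suc n := \<theta>)) {1..n}"
      by (subst inj_on_cong[where g = "?P \<circ> e"]) auto
    moreover have "\<theta> \<notin> ?S" by (rule contrapos_nn[OF \<theta>_notin]) (rule span_base)
    then have "\<theta> \<notin> ((?P \<circ> e)(Suc n := \<theta>)) ` {1..n}" by (auto simp: image_image)
    ultimately show ?thesis
      by (simp add: atLeastAtMostSuc_conv)
  qed
  ultimately show ?thesis
    using ind' unfolding coframe_def im by blast
qed

lemma half_omega_squared:
  fixes e :: "nat \<Rightarrow> ('v::real_vector, real) form"
  assumes "\<And>i. i \<in> {1..6} \<Longrightarrow> alt_form 1 (e i)"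
    and "\<omega> = e 1 \<^bold>\<and> e 2 + e 3 \<^bold>\<and> e 4 + e 5 \<^bold>\<and> e 6"
  shows "(1 / 2) *\<^sub>R (\<omega> \<^bold>\<and> \<omega>) = e 3 \<^bold>\<and> e 4 \<^bold>\<and> e 5 \<^bold>\<and> e 6 + e 1 \<^bold>\<and> e 2 \<^bold>\<and> e 5 \<^bold>\<and> e 6 + e 1 \<^bold>\<and> e 2 \<^bold>\<and> e 3 \<^bold>\<and> e 4"
proof -
  have commute: "(e i \<^bold>\<and> e j) \<^bold>\<and> e k \<^bold>\<and> e l = (e k \<^bold>\<and> e l) \<^bold>\<and> e i \<^bold>\<and> e j"
    if "i \<in> {1..6}" "j \<in> {1..6}" "k \<in> {1..6}" "l \<in> {1..6}" for i j k l
  proof -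
    have kl: "grade_inv (e k \<^bold>\<and> e l) = e k \<^bold>\<and> e l"
      using that assms(1) by (simp add: grade_inv_wedge grade_inv_one_form[OF assms(1)] wedge_linear)
    show ?thesis
      using one_form_wedge_commute[OF assms(1)[OF that(2)], of "e k \<^bold>\<and> e l"]
        one_form_wedge_commute[OF assms(1)[OF that(1)], of "e k \<^bold>\<and> e l"]
      by (metis kl wedge_assoc)
  qed
  have self: "(e i \<^bold>\<and> e j) \<^bold>\<and> e i \<^bold>\<and> e j = 0" if "i \<in> {1..6}" "j \<in> {1..6}" for i j
  proof -
    have "e j \<^bold>\<and> e i \<^bold>\<and> e j = (e i \<^bold>\<and> e j) \<^bold>\<and> e j"
      using one_form_wedge_commute[OF assms(1)[OF that(2)], of "e i \<^bold>\<and> e j"] that assms(1)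
      by (simp add: grade_inv_wedge grade_inv_one_form[OF assms(1)] wedge_linear)
    also have "\<dots> = 0" using one_form_wedge_self[OF assms(1)[OF that(2)]] by (simp add: wedge_assoc wedge_linear)
    finally show ?thesis by (simp add: wedge_assoc wedge_linear)
  qed
  have "\<omega> \<^bold>\<and> \<omega> = (e 3 \<^bold>\<and> e 4) \<^bold>\<and> e 5 \<^bold>\<and> e 6 + (e 1 \<^bold>\<and> e 2) \<^bold>\<and> e 5 \<^bold>\<and> e 6 + (e 1 \<^bold>\<and> e 2) \<^bold>\<and> e 3 \<^bold>\<and> e 4
      + ((e 3 \<^bold>\<and> e 4) \<^bold>\<and> e 5 \<^bold>\<and> e 6 + (e 1 \<^bold>\<and> e 2) \<^bold>\<and> e 5 \<^bold>\<and> e 6 + (e 1 \<^bold>\<and> e 2) \<^bold>\<and> e 3 \<^bold>\<and> e 4)"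
    unfolding assms(2) wedge_linear
    using self[of 1 2] self[of 3 4] self[of 5 6] commute[of 3 4 1 2] commute[of 5 6 1 2] commute[of 5 6 3 4]
    by simp
  then show ?thesis by (simp add: wedge_assoc fun_eq_iff)
qed

lemma su3_psi_minus:
  fixes e :: "nat \<Rightarrow> ('v, real) form"
  assumes "complex_form \<psi>p \<psi>m
    = complex_form (e 1) (e 2) \<^bold>\<and> complex_form (e 3) (e 4) \<^bold>\<and> complex_form (e 5) (e 6)"
  shows "\<psi>m = e 1 \<^bold>\<and> e 3 \<^bold>\<and> e 6 + e 1 \<^bold>\<and> e 4 \<^bold>\<and> e 5 + e 2 \<^bold>\<and> e 3 \<^bold>\<and> e 5 - e 2 \<^bold>\<and> e 4 \<^bold>\<and> e 6"
proof -
  have inj: "\<beta> = \<delta>" if "complex_form \<alpha> \<beta> = complex_form \<gamma> \<delta>" for \<alpha> \<beta> \<gamma> \<delta> :: "('v, real) form"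
    using that by (simp add: complex_form_def fun_eq_iff)
  show ?thesis
    using inj[OF assms[unfolded wedge_complex_form]] by (simp add: wedge_linear algebra_simps)
qed

section \<open>The structure on the direct sum\<close>

theorem theorem1:
  fixes br :: "'h::real_vector \<Rightarrow> 'h \<Rightarrow> 'h"
    and \<omega> \<psi>p \<psi>m :: "('h, real) form"
    and \<theta> :: "('h \<times> real, real) form"
  assumes "lie_algebra br"
    and "dim (UNIV :: 'h set) = 6"
    and "nilpotent_lie br"
    and "su3_structure \<omega> \<psi>p \<psi>m"
    and "nearly_half_flat br \<omega> \<psi>m"
    and "alt_form 1 \<theta>"
    and "ce_diff (lie_direct_sum br (\<lambda>_ _. 0)) \<theta> = 0"
    and "\<theta> [(0, 1)] = 1"
  shows "\<exists>\<phi>. lc_cocalibrated_g2 (lie_direct_sum br (\<lambda>_ _. 0)) \<theta> \<phi>"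
proof -
  let ?br = "lie_direct_sum br (\<lambda>_ _. 0) :: 'h \<times> real \<Rightarrow> 'h \<times> real \<Rightarrow> 'h \<times> real"
  let ?P = "pullback fst :: ('h, real) form \<Rightarrow> ('h \<times> real, real) form"
  from assms(4) obtain e where e: "coframe 6 e"
    and \<omega>: "\<omega> = e 1 \<^bold>\<and> e 2 + e 3 \<^bold>\<and> e 4 + e 5 \<^bold>\<and> e 6"
    and "complex_form \<psi>p \<psi>m
      = complex_form (e 1) (e 2) \<^bold>\<and> complex_form (e 3) (e 4) \<^bold>\<and> complex_form (e 5) (e 6)"
    unfolding su3_structure_def by blast
  then have \<psi>m: "\<psi>m = e 1 \<^bold>\<and> e 3 \<^bold>\<and> e 6 + e 1 \<^bold>\<and> e 4 \<^bold>\<and> e 5 + e 2 \<^bold>\<and> e 3 \<^bold>\<and> e 5 - e 2 \<^bold>\<and> e 4 \<^bold>\<and> e 6"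
    by (intro su3_psi_minus)
  note alt_e = coframe_alt_form[OF e]
  define f where "f = (?P \<circ> e)(Suc 6 := \<theta>)"
  have f: "f i = ?P (e i)" if "i \<noteq> 7" for i using that by (simp add: f_def)
  have f7: "f 7 = \<theta>" by (simp add: f_def)
  have cof: "coframe 7 f"
    using coframe_extend[OF e assms(6,8)] by (simp add: f_def)
  define \<phi> where "\<phi> = f 1 \<^bold>\<and> f 2 \<^bold>\<and> f 7 + f 3 \<^bold>\<and> f 4 \<^bold>\<and> f 7 + f 5 \<^bold>\<and> f 6 \<^bold>\<and> f 7
      + f 1 \<^bold>\<and> f 3 \<^bold>\<and> f 5 - f 1 \<^bold>\<and> f 4 \<^bold>\<and> f 6 - f 2 \<^bold>\<and> f 3 \<^bold>\<and> f 6 - f 2 \<^bold>\<and> f 4 \<^bold>\<and> f 5"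
  define \<sigma> where "\<sigma> = (1 / 2) *\<^sub>R (\<omega> \<^bold>\<and> \<omega>)"
  have alt2: "alt_form 2 (e i \<^bold>\<and> e j)" if "i \<in> {1..6}" "j \<in> {1..6}" for i j
    using alt_form_wedge[OF alt_e[OF that(1)] alt_e[OF that(2)]] by (simp add: numeral_2_eq_2)
  have alt3: "alt_form 3 (e i \<^bold>\<and> e j \<^bold>\<and> e k)" if "i \<in> {1..6}" "j \<in> {1..6}" "k \<in> {1..6}" for i j k
    using alt_form_wedge[OF alt_e[OF that(1)] alt2[OF that(2,3)]] by (simp add: numeral_3_eq_3)
  have "alt_form 2 \<omega>" unfolding \<omega> by (intro alt_form_add alt2) auto
  then have "alt_form 4 \<sigma>"
    unfolding \<sigma>_def using alt_form_wedge[of 2 \<omega> 2 \<omega>] by (simp add: alt_form_scaleR)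
  then have \<sigma>: "alt_form 4 (?P \<sigma>)" by (rule alt_form_pullback[OF linear_fst])
  have alt\<psi>: "alt_form 3 \<psi>m" unfolding \<psi>m by (intro alt_form_add alt_form_diff alt3) auto
  then have P\<psi>: "alt_form 3 (?P \<psi>m)" by (rule alt_form_pullback[OF linear_fst])
  (* Along f, the pullbacks of \<omega> and \<psi>m have the same coordinate expressions as \<omega> and \<psi>m along e. *)
  have star: "hodge_star 7 f \<phi> = ?P \<sigma> + ?P \<psi>m \<^bold>\<and> \<theta>"
  proof -
    have "?P \<sigma> = f 3 \<^bold>\<and> f 4 \<^bold>\<and> f 5 \<^bold>\<and> f 6 + f 1 \<^bold>\<and> f 2 \<^bold>\<and> f 5 \<^bold>\<and> f 6 + f 1 \<^bold>\<and> f 2 \<^bold>\<and> f 3 \<^bold>\<and> f 4"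
    proof -
      have "\<sigma> = e 3 \<^bold>\<and> e 4 \<^bold>\<and> e 5 \<^bold>\<and> e 6 + e 1 \<^bold>\<and> e 2 \<^bold>\<and> e 5 \<^bold>\<and> e 6 + e 1 \<^bold>\<and> e 2 \<^bold>\<and> e 3 \<^bold>\<and> e 4"
        unfolding \<sigma>_def using alt_e \<omega> by (rule half_omega_squared)
      then show ?thesis by (simp add: pullback_linear pullback_wedge f)
    qed
    moreover have "?P \<psi>m \<^bold>\<and> \<theta> = f 1 \<^bold>\<and> f 3 \<^bold>\<and> f 6 \<^bold>\<and> f 7 + f 1 \<^bold>\<and> f 4 \<^bold>\<and> f 5 \<^bold>\<and> f 7
        + f 2 \<^bold>\<and> f 3 \<^bold>\<and> f 5 \<^bold>\<and> f 7 - f 2 \<^bold>\<and> f 4 \<^bold>\<and> f 6 \<^bold>\<and> f 7"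
      unfolding \<psi>m by (simp add: pullback_linear pullback_wedge f f7 wedge_linear wedge_assoc)
    ultimately show ?thesis unfolding \<phi>_def hodge_star_g2[OF cof] by simp
  qed
  have d_pullback: "ce_diff ?br (?P \<alpha>) = ?P (ce_diff br \<alpha>)" for \<alpha>
    by (rule ce_diff_pullback) (simp add: lie_direct_sum_def)
  have d\<psi>: "ce_diff br \<psi>m = \<sigma>" using assms(5) by (simp add: nearly_half_flat_def \<sigma>_def)
  have "ce_diff br \<sigma> = 0" using ce_diff_ce_diff[OF assms(1) alt\<psi>] by (simp add: d\<psi>)
  then have "ce_diff ?br (hodge_star 7 f \<phi>) = ?P \<sigma> \<^bold>\<and> \<theta>"
    by (simp add: star ce_diff_linear ce_diff_wedge[OF P\<psi> assms(6)] d_pullback d\<psi> assms(7)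
        pullback_linear wedge_linear)
  also have "\<dots> = \<theta> \<^bold>\<and> hodge_star 7 f \<phi>"
  proof -
    have "\<theta> \<^bold>\<and> ?P \<sigma> = ?P \<sigma> \<^bold>\<and> \<theta>"
      using one_form_wedge_commute[OF assms(6), of "?P \<sigma>"] by (simp add: grade_inv_alt_form[OF \<sigma>])
    moreover have "\<theta> \<^bold>\<and> ?P \<psi>m \<^bold>\<and> \<theta> = 0"
      using one_form_wedge_commute[OF assms(6), of "?P \<psi>m \<^bold>\<and> \<theta>"]
      by (simp add: grade_inv_wedge grade_inv_one_form[OF assms(6)] wedge_assoc
          one_form_wedge_self[OF assms(6)] wedge_linear)
    ultimately show ?thesis by (simp add: star wedge_linear)
  qed
  finally have "ce_diff ?br (hodge_star 7 f \<phi>) = \<theta> \<^bold>\<and> hodge_star 7 f \<phi>" .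
  moreover have "g2_coframe f \<phi>" using cof by (simp add: g2_coframe_def \<phi>_def)
  moreover have "\<theta> \<noteq> 0" using assms(8) by (auto simp: zero_fun_def)
  ultimately show ?thesis
    using assms(6,7) unfolding lc_cocalibrated_g2_def by blast
qed

end
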